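(* For any $n\in\mathbb N$ with $n>1$, there exists a finitely generated polynomial semigroup $G_n=\langle h_1,\dots,h_{2n}\rangle$ in $\mathcal G$ satisfying $\sharp(\hat{\mathcal J}_{G_n})=n$. In fact, let $0<\epsilon<\frac12$ and for each $j=1,\dots,n$ set $\alpha_j(z)=\frac1jz^2$ and $\beta_j(z)=\frac1j(z-\epsilon)^2+\epsilon$. Then, for any sufficiently large $l\in\mathbb N$, there exists an open neighborhood $V$ of $(\alpha_1^l,\dots,\alpha_n^l,\beta_1^l,\dots,\beta_n^l)$ in $(\mathrm{Poly})^{2n}$ such that for any $(h_1,\dots,h_{2n})\in V$, the semigroup $G=\langle h_1,\dots,h_{2n}\rangle$ satisfies $G\in\mathcal G$ and $\sharp(\hat{\mathcal J}_G)=n$.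
   Context: $\hat{\mathbb C}$ is the Riemann sphere. A polynomial semigroup is a semigroup (under composition) generated by a family of non-constant polynomial maps on $\hat{\mathbb C}$; $\langle h_1,\dots,h_k\rangle$ is the semigroup generated by $h_1,\dots,h_k$. $\mathrm{Poly}$ is the set of non-constant polynomial maps $\hat{\mathbb C}\to\hat{\mathbb C}$ with the topology of uniform convergence on $\hat{\mathbb C}$ with respect to the spherical distance. $\alpha^l$ denotes the $l$-fold iterate of $\alpha$. The Fatou set $F(G)$ is the set of $z\in\hat{\mathbb C}$ having a neighborhood on which $G$ is a normal family; the Julia set is $J(G)=\hat{\mathbb C}\setminus F(G)$. $P(G)=\overline{\bigcup_{g\in G}\{\text{critical values of } g:\hat{\mathbb C}\to\hat{\mathbb C}\}}$ and $P^{*}(G)=P(G)\setminus\{\infty\}$. $\mathcal G$ is the set of polynomial semigroups $G$ all of whose elements have degree at least two and for which $P^{*}(G)$ is bounded in $\mathbb C$. $\hat{\mathcal J}_G$ is the set of all connected components of $J(G)$; $\sharp$ denotes cardinality. *)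

theory Defs
  imports "HOL-Analysis.Analysis" "HOL-Computational_Algebra.Polynomial"
begin

section \<open>The Riemann sphere with the spherical distance\<close>

datatype rsphere = Fin complex | Infty

text \<open>Stereographic projection onto the unit sphere of \<open>complex \<times> real\<close>, with north pole \<open>(0, 1)\<close>.\<close>

fun stereo :: "rsphere \<Rightarrow> complex \<times> real" where
  "stereo (Fin z) = ((2 / (1 + (norm z)\<^sup>2)) *\<^sub>R z, ((norm z)\<^sup>2 - 1) / ((norm z)\<^sup>2 + 1))"
| "stereo Infty = (0, 1)"

lemma norm_stereo [simp]: "norm (stereo p) = 1"
proof (cases p)
  case (Fin z)
  define r where "r = (norm z)\<^sup>2"
  have r: "r \<ge> 0" by (simp add: r_def)
  have "(norm (stereo p))\<^sup>2 = (2 / (1 + r))\<^sup>2 * r + ((r - 1) / (r + 1))\<^sup>2"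
    using r by (simp add: Fin norm_Pair r_def[symmetric] power_mult_distrib power_divide)
  also have "\<dots> = (4 * r + (r - 1)\<^sup>2) / (r + 1)\<^sup>2"
    by (simp add: power_divide add.commute add_divide_distrib)
  also have "4 * r + (r - 1)\<^sup>2 = (r + 1)\<^sup>2"
    by (simp add: power2_eq_square algebra_simps)
  finally have "(norm (stereo p))\<^sup>2 = 1\<^sup>2"
    using r by simp
  then show ?thesis
    by (metis norm_ge_zero power2_eq_iff_nonneg zero_le_one)
qed (simp add: norm_Pair)

lemma stereo_inject [simp]: "stereo p = stereo q \<longleftrightarrow> p = q"
proof
  have height: "(r - 1) / (r + 1) \<noteq> 1" if "r \<ge> 0" for r :: real
    using that by (simp add: divide_eq_eq)
  assume eq: "stereo p = stereo q"
  show "p = q"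
  proof (cases p; cases q)
    fix z w assume pq: "p = Fin z" "q = Fin w"
    define r s where "r = (norm z)\<^sup>2" and "s = (norm w)\<^sup>2"
    have rs: "r \<ge> 0" "s \<ge> 0" by (auto simp: r_def s_def)
    have "(r - 1) / (r + 1) = (s - 1) / (s + 1)" and zw: "(2 / (1 + r)) *\<^sub>R z = (2 / (1 + s)) *\<^sub>R w"
      using eq by (simp_all add: pq r_def s_def)
    then have "(r - 1) * (s + 1) = (s - 1) * (r + 1)"
      using rs by (simp add: frac_eq_eq)
    then have "r = s" by (simp add: algebra_simps)
    moreover have "2 / (1 + s) \<noteq> 0" using rs by simp
    ultimately show ?thesis using zw pq by simp
  qed (use eq height in auto)
qed simp

lemma abs_inner_le_one:
  fixes a b :: "'a::real_inner"
  assumes "norm a = 1" "norm b = 1"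
  shows "\<bar>a \<bullet> b\<bar> \<le> 1"
  using Cauchy_Schwarz_ineq2[of a b] assms by simp

lemma arccos_inner_triangle:
  fixes a b c :: "'a::real_inner"
  assumes "norm a = 1" "norm b = 1" "norm c = 1"
  shows "arccos (a \<bullet> c) \<le> arccos (a \<bullet> b) + arccos (b \<bullet> c)"
proof -
  define A B where "A = arccos (a \<bullet> b)" and "B = arccos (b \<bullet> c)"
  have bounds: "\<bar>a \<bullet> b\<bar> \<le> 1" "\<bar>b \<bullet> c\<bar> \<le> 1" "\<bar>a \<bullet> c\<bar> \<le> 1"
    using assms by (auto intro: abs_inner_le_one)
  have one: "a \<bullet> a = 1" "b \<bullet> b = 1" "c \<bullet> c = 1"
    using assms by (simp_all add: norm_eq_1)
  have A: "0 \<le> A" "A \<le> pi" "cos A = a \<bullet> b" and B: "0 \<le> B" "B \<le> pi" "cos B = b \<bullet> c"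
    using bounds by (auto simp: A_def B_def cos_arccos_abs intro!: arccos_lbound arccos_ubound)
  show ?thesis
  proof (cases "A + B \<le> pi")
    case True
    define a' c' where "a' = a - (a \<bullet> b) *\<^sub>R b" and "c' = c - (b \<bullet> c) *\<^sub>R b"
    have "a' \<bullet> a' = 1 - (cos A)\<^sup>2"
      by (simp add: a'_def A inner_diff inner_commute one power2_eq_square)
    then have na: "norm a' = sin A"
      using sin_ge_zero[OF A(1,2)] by (simp add: norm_eq_sqrt_inner sin_squared_eq[symmetric])
    have "c' \<bullet> c' = 1 - (cos B)\<^sup>2"
      by (simp add: c'_def B inner_diff inner_commute one power2_eq_square)
    then have nc: "norm c' = sin B"
      using sin_ge_zero[OF B(1,2)] by (simp add: norm_eq_sqrt_inner sin_squared_eq[symmetric])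
    have "a \<bullet> c = cos A * cos B + a' \<bullet> c'"
      by (simp add: a'_def c'_def A B inner_diff inner_commute one)
    moreover have "- (sin A * sin B) \<le> a' \<bullet> c'"
      using Cauchy_Schwarz_ineq2[of a' c'] na nc by simp
    ultimately have "cos (A + B) \<le> a \<bullet> c"
      by (simp add: cos_add)
    then have "arccos (a \<bullet> c) \<le> arccos (cos (A + B))"
      using bounds by (intro arccos_le_arccos) auto
    also have "\<dots> = A + B"
      using True A B by (intro arccos_cos) auto
    finally show ?thesis by (simp add: A_def B_def)
  next
    case False
    have "arccos (a \<bullet> c) \<le> pi"
      using bounds by (intro arccos_ubound) auto
    with False show ?thesis by (simp add: A_def B_def)
  qed
qed

instantiation rsphere :: dist
begin

text \<open>The great-circle distance, i.e. the geodesic distance of the metric \<open>2|dz| / (1 + |z|\<^sup>2)\<close>.\<close>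

definition
  "dist (p :: rsphere) q = arccos (stereo p \<bullet> stereo q)"

instance ..

end

instantiation rsphere :: uniformity_dist
begin

definition
  "(uniformity :: (rsphere \<times> rsphere) filter) = (INF e\<in>{0<..}. principal {(x, y). dist x y < e})"

instance by standard (rule uniformity_rsphere_def)

end

instantiation rsphere :: open_uniformity
begin

definition
  "open (U :: rsphere set) \<longleftrightarrow> (\<forall>x\<in>U. eventually (\<lambda>(x', y). x' = x \<longrightarrow> y \<in> U) uniformity)"

instance by standard (rule open_rsphere_def)

end

instantiation rsphere :: metric_space
begin

instance
proof
  fix p q s :: rsphere
  have bound: "\<bar>stereo p \<bullet> stereo q\<bar> \<le> 1"
    by (intro abs_inner_le_one) auto
  have one: "stereo x \<bullet> stereo x = 1" for x
    by (simp flip: norm_eq_1)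
  show "dist p q = 0 \<longleftrightarrow> p = q"
  proof
    assume "dist p q = 0"
    then have "stereo p \<bullet> stereo q = 1"
      using bound by (metis cos_arccos_abs cos_zero dist_rsphere_def)
    then have "(norm (stereo p - stereo q))\<^sup>2 = 0"
      by (simp add: power2_norm_eq_inner inner_diff inner_commute one)
    then show "p = q" by simp
  next
    assume "p = q"
    then show "dist p q = 0" by (simp add: dist_rsphere_def one)
  qed
  show "dist p q \<le> dist p s + dist q s"
    using arccos_inner_triangle[of "stereo p" "stereo s" "stereo q"]
    by (simp add: dist_rsphere_def inner_commute)
qed

end

lemma dist_rsphere_le_pi: "dist (p::rsphere) q \<le> pi"
  unfolding dist_rsphere_def
  using abs_inner_le_one[of "stereo p" "stereo q"] by (intro arccos_ubound) auto


section \<open>The space of non-constant polynomial maps\<close>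

text \<open>The value at \<open>Infty\<close> is the right one for non-constant polynomials only; constant ones are
  never used.\<close>

fun poly_map :: "complex poly \<Rightarrow> rsphere \<Rightarrow> rsphere" where
  "poly_map p (Fin z) = Fin (poly p z)"
| "poly_map p Infty = Infty"

definition Poly_maps :: "(rsphere \<Rightarrow> rsphere) set" where
  "Poly_maps = {poly_map p | p. degree p \<ge> 1}"

definition Poly_topology :: "(rsphere \<Rightarrow> rsphere) topology" where
  "Poly_topology = subtopology (mtopology_of (funspace UNIV euclidean_metric)) Poly_maps"

lemma mspace_funspace_rsphere:
  "mspace (funspace UNIV (euclidean_metric :: rsphere metric)) = (UNIV :: ('a \<Rightarrow> rsphere) set)"
proof -
  have "Met_TC.mbounded S" for S :: "rsphere set"
    unfolding Met_TC.mbounded_def by (rule exI[of _ Infty], rule exI[of _ pi]) (auto simp: dist_rsphere_le_pi)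
  then show ?thesis by (auto simp: Met_TC.fspace_def)
qed

lemma topspace_Poly_topology [simp]: "topspace Poly_topology = Poly_maps"
  by (simp only: Poly_topology_def topspace_subtopology topspace_mtopology_of
      mspace_funspace_rsphere Int_UNIV_left)

lemma mdist_funspace_rsphere:
  "mdist (funspace UNIV (euclidean_metric :: rsphere metric)) f g = (SUP z. dist (f z) (g z))"
proof -
  have "Met_TC.fspace UNIV = (UNIV :: ('a \<Rightarrow> rsphere) set)"
    using mspace_funspace_rsphere by simp
  then show ?thesis by (simp add: Met_TC.fdist_def)
qed


section \<open>Polynomial semigroups\<close>

inductive_set semigroup_gen :: "(rsphere \<Rightarrow> rsphere) set \<Rightarrow> (rsphere \<Rightarrow> rsphere) set"
  for H :: "(rsphere \<Rightarrow> rsphere) set" where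
  gen: "h \<in> H \<Longrightarrow> h \<in> semigroup_gen H"
| comp: "f \<in> semigroup_gen H \<Longrightarrow> g \<in> semigroup_gen H \<Longrightarrow> f \<circ> g \<in> semigroup_gen H"

definition polynomial_semigroup :: "(rsphere \<Rightarrow> rsphere) set \<Rightarrow> bool" where
  "polynomial_semigroup G \<longleftrightarrow> (\<exists>H. H \<noteq> {} \<and> H \<subseteq> Poly_maps \<and> G = semigroup_gen H)"

definition normal_family_on :: "rsphere set \<Rightarrow> (rsphere \<Rightarrow> rsphere) set \<Rightarrow> bool" where
  "normal_family_on U G \<longleftrightarrow>
     (\<forall>s :: nat \<Rightarrow> rsphere \<Rightarrow> rsphere. range s \<subseteq> G \<longrightarrow>
        (\<exists>r f. strict_mono r \<and>
           (\<forall>K. compact K \<and> K \<subseteq> U \<longrightarrow> uniform_limit K (s \<circ> r) f sequentially)))"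

definition Fatou :: "(rsphere \<Rightarrow> rsphere) set \<Rightarrow> rsphere set" where
  "Fatou G = {z. \<exists>U. open U \<and> z \<in> U \<and> normal_family_on U G}"

definition Julia :: "(rsphere \<Rightarrow> rsphere) set \<Rightarrow> rsphere set" where
  "Julia G = - Fatou G"


section \<open>Critical values and the postcritical set\<close>

text \<open>The coordinate change \<open>z \<mapsto> 1/z\<close>.\<close>

fun inversion :: "rsphere \<Rightarrow> rsphere" where
  "inversion (Fin z) = (if z = 0 then Infty else Fin (1 / z))"
| "inversion Infty = Fin 0"

text \<open>\<open>coord p\<close> is the standard chart around \<open>p\<close> (\<open>z\<close> if \<open>p\<close> is finite, \<open>1/z\<close> if \<open>p = Infty\<close>) and
  \<open>param p\<close> its inverse. The one point outside the domain of the chart gets the dummy value \<open>0\<close>.\<close>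

fun finite_part :: "rsphere \<Rightarrow> complex" where
  "finite_part (Fin z) = z"
| "finite_part Infty = 0"

fun coord :: "rsphere \<Rightarrow> rsphere \<Rightarrow> complex" where
  "coord (Fin a) q = finite_part q"
| "coord Infty q = finite_part (inversion q)"

fun param :: "rsphere \<Rightarrow> complex \<Rightarrow> rsphere" where
  "param (Fin a) w = Fin w"
| "param Infty w = inversion (Fin w)"

definition critical_point :: "(rsphere \<Rightarrow> rsphere) \<Rightarrow> rsphere \<Rightarrow> bool" where
  "critical_point g p \<longleftrightarrow>
     ((\<lambda>w. coord (g p) (g (param p w))) has_field_derivative 0) (at (coord p p))"

definition critical_values :: "(rsphere \<Rightarrow> rsphere) \<Rightarrow> rsphere set" where
  "critical_values g = g ` {p. critical_point g p}"

definition postcritical :: "(rsphere \<Rightarrow> rsphere) set \<Rightarrow> rsphere set" where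
  "postcritical G = closure (\<Union>g\<in>G. critical_values g)"

definition postcritical_star :: "(rsphere \<Rightarrow> rsphere) set \<Rightarrow> rsphere set" where
  "postcritical_star G = postcritical G - {Infty}"

lemma critical_point_Fin:
  "critical_point (poly_map p) (Fin z) \<longleftrightarrow> poly (pderiv p) z = 0"
  by (simp add: critical_point_def) (metis DERIV_unique poly_DERIV)

definition class_G :: "(rsphere \<Rightarrow> rsphere) set set" where
  "class_G = {G. polynomial_semigroup G \<and>
                 (\<forall>g\<in>G. \<exists>p. degree p \<ge> 2 \<and> g = poly_map p) \<and>
                 bounded (Fin -` postcritical_star G)}"


section \<open>The maps of the example\<close>

definition alpha_map :: "nat \<Rightarrow> rsphere \<Rightarrow> rsphere" where
  "alpha_map j = poly_map (smult (1 / of_nat j) ([:0, 1:] ^ 2))"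

definition beta_map :: "real \<Rightarrow> nat \<Rightarrow> rsphere \<Rightarrow> rsphere" where
  "beta_map \<epsilon> j =
     poly_map (smult (1 / of_nat j) ([:- of_real \<epsilon>, 1:] ^ 2) + [:of_real \<epsilon>:])"

end

theory Submission
  imports Defs "HOL-Complex_Analysis.Complex_Analysis"
    "HOL-Computational_Algebra.Fundamental_Theorem_Algebra"
begin

text \<open>For large \<open>l\<close> the generators \<open>h\<^sub>j\<close> and \<open>h\<^sub>n\<^sub>+\<^sub>j\<close> map a small disc \<open>D = {|z| \<le> r}\<close> into itself and
  the set \<open>{|z| \<ge> R}\<close> into itself, and the preimage of the annulus \<open>W = {r \<le> |z| \<le> R}\<close> under them lies
  in thin annuli around the circles of radius \<open>j\<close> centred at \<open>0\<close> and at \<open>\<epsilon>\<close>. For the centre \<open>c\<close> of the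
  circle, all solutions of \<open>h(z) = c\<close> lie in \<open>D\<close>, so \<open>z h'(z) / (h(z) - c)\<close> has real part at least
  \<open>deg h / 2\<close> outside \<open>D\<close>; hence the critical points lie in \<open>D\<close> and \<open>h\<close> expands on the preimage of \<open>W\<close>.
  Only the inclusions and the location of the solutions of \<open>h(z) = c\<close> need to be checked for spherical
  perturbations of the generators, because the growth of \<open>h\<close> between the two sides of the circle
  forces its degree to be large.

  The Julia set is the intersection of the sets \<open>W\<^sub>k\<close> of points that some word of length \<open>k\<close> maps
  into \<open>W\<close>: Montel's theorem gives normality off \<open>W\<^sub>k\<close>, and expansion contradicts normality on the
  intersection. The preimage of \<open>W\<close> under a single word is connected and separates \<open>D\<close> from infinity.
  The two circles of radius \<open>j\<close> cross, so the preimages under words beginning with \<open>h\<^sub>j\<close> and with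
  \<open>h\<^sub>n\<^sub>+\<^sub>j\<close> meet, whereas circles of different radii are disjoint. So \<open>W\<^sub>k\<close> has exactly one component
  near each of the \<open>n\<close> radii, and so does the intersection.\<close>

section \<open>Topology of the Riemann sphere\<close>

text \<open>A great-circle arc of length d <= pi has a chord of length 2 sin (d/2) <= d; this makes
  \<open>stereo\<close> 1-Lipschitz.\<close>

lemma norm_stereo_diff_le_dist: "norm (stereo p - stereo q) \<le> dist p q"
proof -
  define d where "d = dist p q"
  have "\<bar>stereo p \<bullet> stereo q\<bar> \<le> 1"
    by (intro abs_inner_le_one norm_stereo)
  then have d: "0 \<le> d" "d \<le> pi" and c: "cos d = stereo p \<bullet> stereo q"
    by (simp_all add: d_def dist_rsphere_def cos_arccos_abs arccos_lbound arccos_ubound)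
  have "stereo x \<bullet> stereo x = 1" for x
    by (simp flip: norm_eq_1)
  then have "(norm (stereo p - stereo q))\<^sup>2 = 2 - 2 * cos d"
    by (simp add: power2_norm_eq_inner inner_diff inner_commute c)
  also have "\<dots> = (2 * sin (d / 2))\<^sup>2"
    using cos_double_sin[of "d / 2"] by (simp add: power2_eq_square)
  finally have "norm (stereo p - stereo q) = 2 * sin (d / 2)"
    using d by (subst (asm) power2_eq_iff_nonneg) (auto intro!: sin_ge_zero)
  also have "\<dots> \<le> d"
    using sin_x_le_x[of "d / 2"] d by simp
  finally show ?thesis by (simp add: d_def)
qed

lemma continuous_on_stereo: "continuous_on S stereo"
  unfolding continuous_on_iff
  by (metis dist_norm norm_stereo_diff_le_dist order.strict_trans1)

lemma continuous_on_finite_part: "continuous_on (range Fin) finite_part"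
proof -
  \<comment> \<open>The formula inverts the stereographic projection from the north pole; its
    denominator vanishes only at \<open>Infty\<close>.\<close>
  have "continuous_on (range Fin) (\<lambda>p. (1 / (1 - snd (stereo p))) *\<^sub>R fst (stereo p))"
  proof (intro continuous_intros continuous_on_fst continuous_on_snd continuous_on_stereo ballI)
    fix p assume "p \<in> range Fin"
    then show "1 - snd (stereo p) \<noteq> 0"
      by (auto simp: field_simps add_nonneg_eq_0_iff)
  qed
  moreover have "(1 / (1 - snd (stereo (Fin z)))) *\<^sub>R fst (stereo (Fin z)) = z" for z
  proof -
    have "1 - ((norm z)\<^sup>2 - 1) / ((norm z)\<^sup>2 + 1) = 2 / (1 + (norm z)\<^sup>2)"
      by (simp add: field_simps add_nonneg_eq_0_iff)
    moreover have "(1 / (2 / c)) *\<^sub>R (2 / c) *\<^sub>R z = z" if "c \<noteq> 0" for c :: real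
      using that by simp
    moreover have "1 + (norm z)\<^sup>2 \<noteq> 0"
      by (simp add: add_nonneg_eq_0_iff)
    ultimately show ?thesis
      by (simp only: stereo.simps fst_conv snd_conv)
  qed
  ultimately show ?thesis
    by (subst continuous_on_cong[OF refl]) auto
qed

lemma continuous_on_Fin [continuous_intros]:
  assumes "continuous_on S f"
  shows "continuous_on S (\<lambda>x. Fin (f x))"
proof -
  have nz: "1 + (norm z)\<^sup>2 \<noteq> 0" "(norm z)\<^sup>2 + 1 \<noteq> 0" for z :: complex
    by (simp_all add: add_nonneg_eq_0_iff)
  have "continuous_on UNIV Fin"
    unfolding continuous_on_def
  proof
    fix a
    have inn: "stereo p \<bullet> stereo q \<in> {-1..1}" for p q
      using abs_inner_le_one[OF norm_stereo norm_stereo, of p q] by (simp only: atLeastAtMost_iff abs_le_iff) simp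
    have st: "isCont (\<lambda>z. stereo (Fin z)) a"
      unfolding stereo.simps by (intro isCont_Pair continuous_intros) (simp_all add: nz)
    have "isCont (\<lambda>z. stereo (Fin z) \<bullet> stereo (Fin a)) a"
      by (intro isCont_inner st continuous_const)
    then have "((\<lambda>z. stereo (Fin z) \<bullet> stereo (Fin a)) \<longlongrightarrow> stereo (Fin a) \<bullet> stereo (Fin a)) (at a)"
      by (simp only: isCont_def)
    then have "((\<lambda>z. arccos (stereo (Fin z) \<bullet> stereo (Fin a))) \<longlongrightarrow>
        arccos (stereo (Fin a) \<bullet> stereo (Fin a))) (at a)"
      by (rule continuous_on_tendsto_compose[OF continuous_on_arccos'])
        (intro inn always_eventually allI)+
    then have "((\<lambda>z. dist (Fin z) (Fin a)) \<longlongrightarrow> dist (Fin a) (Fin a)) (at a)"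
      by (simp only: dist_rsphere_def)
    then show "(Fin \<longlongrightarrow> Fin a) (at a)"
      by (subst tendsto_dist_iff) simp
  qed
  then show ?thesis
    using assms continuous_on_compose2 by blast
qed


lemma range_Fin: "range Fin = - {Infty}"
  using rsphere.exhaust by blast

lemma finite_part_image_Fin [simp]: "finite_part ` Fin ` S = S"
  by (simp add: image_image)

lemma open_Fin_image: "open U \<Longrightarrow> open (Fin ` U)"
proof -
  assume "open U"
  moreover have "Fin ` U = range Fin \<inter> finite_part -` U"
    by auto
  ultimately show ?thesis
    using continuous_open_preimage[OF continuous_on_finite_part]
    by (simp add: range_Fin open_Compl)
qed

lemma open_Fin_vimage: "open U \<Longrightarrow> open (Fin -` U)"
  using continuous_on_open_vimage[of UNIV Fin] continuous_on_Fin[of UNIV "\<lambda>x. x"] by simp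

lemma compact_Fin_image [simp]: "compact (Fin ` K) \<longleftrightarrow> compact K"
proof
  assume "compact (Fin ` K)"
  then have "compact (finite_part ` Fin ` K)"
    by (rule compact_continuous_image[rotated])
      (auto intro: continuous_on_subset[OF continuous_on_finite_part])
  then show "compact K" by simp
next
  assume "compact K"
  then show "compact (Fin ` K)"
    by (intro compact_continuous_image continuous_on_Fin continuous_on_id)
qed

lemma connected_Fin_image [simp]: "connected (Fin ` K) \<longleftrightarrow> connected K"
proof
  assume "connected (Fin ` K)"
  then have "connected (finite_part ` Fin ` K)"
    by (rule connected_continuous_image[rotated])
      (auto intro: continuous_on_subset[OF continuous_on_finite_part])
  then show "connected K" by simp
next
  assume "connected K"
  then show "connected (Fin ` K)"
    by (intro connected_continuous_image continuous_on_Fin continuous_on_id)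
qed

section \<open>The inversion as an isometry, and compactness\<close>

text \<open>On the unit sphere 1/z conjugates the horizontal coordinate and negates the height: a
  rotation by pi.\<close>

lemma dist_inversion: "dist (inversion p) (inversion q) = dist p q"
proof -
  have st: "stereo (inversion s) = (cnj (fst (stereo s)), - snd (stereo s))" for s
  proof (cases s)
    case (Fin z)
    have "(2 / (1 + (norm (1 / z))\<^sup>2)) *\<^sub>R (1 / z) = (2 / (1 + (norm z)\<^sup>2)) *\<^sub>R cnj z" if "z \<noteq> 0"
    proof -
      have "(2 / (1 + (norm (1 / z))\<^sup>2)) = (2 / (1 + (norm z)\<^sup>2)) * (norm z)\<^sup>2"
        using that by (simp add: norm_divide field_simps)
      moreover have "(norm z)\<^sup>2 *\<^sub>R (1 / z) = cnj z"
        using that by (simp add: scaleR_conv_of_real complex_norm_square del: of_real_power)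
      ultimately show ?thesis by (metis scaleR_scaleR)
    qed
    moreover have "((norm (1 / z))\<^sup>2 - 1) / ((norm (1 / z))\<^sup>2 + 1) =
        - (((norm z)\<^sup>2 - 1) / ((norm z)\<^sup>2 + 1))" if "z \<noteq> 0"
    proof -
      have "1 + (norm z)\<^sup>2 \<noteq> 0"
        by (simp add: add_nonneg_eq_0_iff)
      then show ?thesis
        using that by (simp add: norm_divide divide_simps)
    qed
    ultimately show ?thesis
      by (auto simp: Fin simp flip: complex_cnj_cnj)
  qed auto
  have "cnj a \<bullet> cnj b = a \<bullet> b" for a b
    by (simp add: inner_complex_def)
  then show ?thesis
    by (simp add: dist_rsphere_def st inner_prod_def)
qed

lemma inversion_inversion [simp]: "inversion (inversion p) = p"
  by (cases p) auto

lemma continuous_on_inversion: "continuous_on S inversion"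
  unfolding continuous_on_iff by (metis dist_inversion)

lemma compact_rsphere_UNIV: "compact (UNIV :: rsphere set)"
proof -
  \<comment> \<open>The closed unit discs of the two charts cover the sphere.\<close>
  have "p \<in> Fin ` cball 0 1 \<union> inversion ` Fin ` cball 0 1" for p
  proof (cases p)
    case (Fin z)
    have "p = inversion (Fin (1 / z))" if "z \<noteq> 0"
      using that by (simp add: Fin)
    moreover have "norm (1 / z) \<le> 1" if "norm z > 1"
      using that by (simp add: norm_divide divide_simps)
    ultimately show ?thesis
      unfolding Fin by (cases "norm z \<le> 1") (force simp del: inversion.simps)+
  next
    case Infty
    then have "p = inversion (Fin 0)" by simp
    then show ?thesis by (simp del: inversion.simps)
  qed
  then have "UNIV = Fin ` cball 0 1 \<union> inversion ` Fin ` cball 0 1"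
    by blast
  also have "compact \<dots>"
    by (intro compact_Un compact_continuous_image[OF continuous_on_inversion]) simp_all
  finally show ?thesis .
qed

lemma compact_complement_nhd_Infty:
  assumes "open U" "Infty \<in> U"
  shows "compact (- (Fin -` U))"
proof -
  have "- U = Fin ` (- (Fin -` U))"
  proof
    show "- U \<subseteq> Fin ` (- (Fin -` U))"
    proof
      fix p assume "p \<in> - U"
      with assms(2) show "p \<in> Fin ` (- (Fin -` U))" by (cases p) auto
    qed
  qed auto
  moreover have "compact (- U)"
    using assms(1) compact_Int_closed[OF compact_rsphere_UNIV, of "- U"] by (simp add: closed_Compl)
  ultimately show ?thesis by simp
qed

lemma open_complement_Fin_image: "compact K \<Longrightarrow> open (- Fin ` K)"
  by (intro open_Compl compact_imp_closed) simp

text \<open>Turns spherical closeness into membership in a Euclidean open set, with one bound for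
  all of \<open>K\<close> by compactness.\<close>

lemma finite_compact_nhd:
  assumes "compact K" "open U" "K \<subseteq> U"
  obtains \<kappa> where "\<kappa> > 0" "\<And>u q. u \<in> K \<Longrightarrow> dist (Fin u) q < \<kappa> \<Longrightarrow> q \<in> Fin ` U"
proof -
  have "compact (Fin ` K)" "open (Fin ` U)" "Fin ` K \<subseteq> Fin ` U"
    using assms by (auto intro: open_Fin_image)
  from compact_subset_open_imp_ball_epsilon_subset[OF this]
  obtain \<kappa> where "\<kappa> > 0" "(\<Union>x\<in>Fin ` K. ball x \<kappa>) \<subseteq> Fin ` U" .
  then show ?thesis
    by (intro that[of \<kappa>]) (fastforce simp: subset_iff)+
qed

section \<open>Polynomials as maps of the plane and the sphere\<close>

lemma poly_map_comp: "poly_map p \<circ> poly_map q = poly_map (pcompose p q)"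
proof
  fix x show "(poly_map p \<circ> poly_map q) x = poly_map (pcompose p q) x"
    by (cases x) (simp_all add: poly_pcompose)
qed

lemma closed_poly_vimage: "closed K \<Longrightarrow> closed (poly p -` K)" for p :: "complex poly"
  using continuous_closed_vimage[of K "poly p"] by simp

text \<open>A non-constant polynomial tends to infinity at infinity, hence is proper. Closedness of
  the map and continuity at \<open>Infty\<close> rest on this.\<close>

lemma compact_poly_vimage:
  fixes p :: "complex poly"
  assumes "degree p \<ge> 1" "compact K"
  shows "compact (poly p -` K)"
proof -
  obtain B where B: "\<And>x. x \<in> K \<Longrightarrow> norm x \<le> B"
    using compact_imp_bounded[OF assms(2)] unfolding bounded_iff by auto
  have "\<forall>\<^sub>F x in at_infinity. B + 1 \<le> norm (poly p x)"
    using filterlim_at_infinity_imp_norm_at_top[OF filterlim_poly_at_infinity[of p]] assms(1)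
    unfolding filterlim_at_top by simp
  then obtain b where b: "\<And>x. b \<le> norm x \<Longrightarrow> B + 1 \<le> norm (poly p x)"
    by (auto simp: eventually_at_infinity)
  have "norm x \<le> b" if "poly p x \<in> K" for x
    using b[of x] B[OF that] by linarith
  then have "bounded (poly p -` K)"
    by (auto simp: bounded_iff)
  then show ?thesis
    using assms(2) by (simp add: compact_eq_bounded_closed closed_poly_vimage)
qed

lemma closed_poly_image:
  fixes p :: "complex poly"
  assumes "degree p \<ge> 1" "closed X"
  shows "closed (poly p ` X)"
proof -
  have "closedin (top_of_set UNIV) (poly p ` X)"
    by (rule proper_map[of UNIV]) (use assms compact_poly_vimage in auto)
  then show ?thesis by simp
qed

lemma open_poly_image:
  fixes p :: "complex poly"
  assumes "degree p \<ge> 1" "open X"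
  shows "open (poly p ` X)"
proof (rule open_mapping_thm[of _ UNIV])
  show "\<not> poly p constant_on UNIV"
    using fundamental_theorem_of_algebra assms(1)
    by (metis UNIV_I constant_def constant_degree constant_on_def not_one_le_zero)
qed (use assms in \<open>auto intro!: holomorphic_intros\<close>)

lemma continuous_on_poly_map:
  assumes "degree p \<ge> 1"
  shows "continuous_on S (poly_map p)"
proof -
  have "open (poly_map p -` U)" if U: "open U" for U
  proof (cases "Infty \<in> U")
    case True
    \<comment> \<open>The complement of a neighbourhood of \<open>Infty\<close> is a compact set of
      the plane, and so is its preimage by properness.\<close>
    have "poly_map p -` U = - Fin ` (poly p -` (- (Fin -` U)))" (is "?L = ?R")
    proof (rule set_eqI)
      fix x show "x \<in> ?L \<longleftrightarrow> x \<in> ?R"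
        using True by (cases x) auto
    qed
    then show ?thesis
      using assms U True
      by (simp only: open_complement_Fin_image compact_poly_vimage compact_complement_nhd_Infty)
  next
    case False
    have "poly_map p -` U = Fin ` (poly p -` (Fin -` U))" (is "?L = ?R")
    proof (rule set_eqI)
      fix x show "x \<in> ?L \<longleftrightarrow> x \<in> ?R"
        using False by (cases x) auto
    qed
    moreover have "open (poly p -` (Fin -` U))"
      by (intro continuous_open_vimage open_Fin_vimage U) simp
    ultimately show ?thesis
      by (simp add: open_Fin_image)
  qed
  then have "continuous_on UNIV (poly_map p)"
    by (simp add: continuous_on_open_vimage)
  then show ?thesis
    using continuous_on_subset by blast
qed

text \<open>Since a polynomial is an open and closed map, each part of a separation of the preimage
  would be mapped onto \<open>T\<close> and hence contain a point of the fibre over \<open>p\<close>.\<close>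

lemma connected_poly_vimage:
  fixes h :: "complex poly"
  assumes deg: "degree h \<ge> 1" and T: "connected T" "closed T" and D: "connected D" "D \<subseteq> poly h -` T"
    and p: "p \<in> T" "poly h -` {p} \<subseteq> D"
  shows "connected (poly h -` T)"
proof (rule ccontr)
  assume "\<not> connected (poly h -` T)"
  then obtain X Y where XY: "closed X" "closed Y" "X \<noteq> {}" "Y \<noteq> {}" "X \<inter> Y = {}" "X \<union> Y = poly h -` T"
    using connected_closed_set[OF closed_poly_vimage[OF T(2)]] by metis
  have onto: "poly h ` X = T"
    if "closed X" "closed Y" "X \<noteq> {}" "X \<inter> Y = {}" "X \<union> Y = poly h -` T" for X Y
  proof -
    have "poly h ` X = T \<inter> poly h ` (- Y)"
      using that by auto
    moreover have "open (poly h ` (- Y))"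
      using that deg by (intro open_poly_image) auto
    ultimately have "openin (top_of_set T) (poly h ` X)"
      by (simp add: openin_open_Int)
    moreover have "closedin (top_of_set T) (poly h ` X)"
      using that deg by (intro closed_subset closed_poly_image) auto
    ultimately show ?thesis
      using T(1) that(3) unfolding connected_clopen by blast
  qed
  have "poly h ` X = T" "poly h ` Y = T"
    using onto[of X Y] onto[of Y X] XY by (auto simp: Un_commute Int_commute)
  then obtain x y where "x \<in> X" "y \<in> Y" "poly h x = p" "poly h y = p"
    using p(1) by (metis imageE)
  then have "x \<in> D \<inter> X" "y \<in> D \<inter> Y"
    using p(2) by auto
  moreover have "D \<subseteq> X \<union> Y"
    using D XY by simp
  ultimately show False
    using connected_closedD[OF D(1), of X Y] XY by blast
qed

section \<open>Estimates from the factorization into linear factors\<close>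

text \<open>The fundamental theorem of algebra splits off a root. The zero polynomial falls under
  the constant case, so the root step may assume a nonzero cofactor.\<close>

lemma complex_poly_root_induct [case_names const root]:
  fixes f :: "complex poly"
  assumes "\<And>c. P [:c:]" "\<And>a f. f \<noteq> 0 \<Longrightarrow> P f \<Longrightarrow> P ([:- a, 1:] * f)"
  shows "P f"
proof (induction "degree f" arbitrary: f)
  case 0
  then show ?case
    using assms(1) by (metis degree_0_id)
next
  case (Suc d)
  then obtain a where "poly f a = 0"
    using fundamental_theorem_of_algebra[of f]
    by (metis constant_degree nat.distinct(1))
  then obtain g where g: "f = [:- a, 1:] * g"
    by (metis dvdE poly_eq_0_iff_dvd)
  then have "g \<noteq> 0"
    using Suc.hyps(2) by auto
  moreover from this have "degree f = Suc (degree g)"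
    unfolding g by (simp add: degree_mult_eq del: mult_pCons_left)
  ultimately show ?case
    using assms(2) Suc.hyps g by simp
qed

text \<open>\<open>z f'/f\<close> is the sum of \<open>z / (z - a)\<close> over the zeros \<open>a\<close> of \<open>f\<close>, and each term has real part
  at least \<open>1/2\<close>.\<close>

lemma Re_log_deriv_poly_ge:
  fixes f :: "complex poly"
  assumes "f \<noteq> 0" "\<And>a. poly f a = 0 \<Longrightarrow> norm a < norm z"
  shows "Re (z * poly (pderiv f) z / poly f z) \<ge> degree f / 2"
  using assms
proof (induction f rule: complex_poly_root_induct)
  case (root a f)
  have nz: "f \<noteq> 0" "poly f z \<noteq> 0" "norm a < norm z" "z \<noteq> a"
    using root.prems by (auto simp del: mult_pCons_left)
  have "z * poly (pderiv ([:- a, 1:] * f)) z / poly ([:- a, 1:] * f) z =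
      z / (z - a) + z * poly (pderiv f) z / poly f z"
  proof -
    have "poly (pderiv ([:- a, 1:] * f)) z = poly f z + (z - a) * poly (pderiv f) z"
      by (simp only: pderiv_mult poly_add poly_mult) (simp add: pderiv_pCons)
    moreover have "poly ([:- a, 1:] * f) z = (z - a) * poly f z"
      by (simp only: poly_mult) simp
    ultimately show ?thesis
      using nz by (simp only:) (simp add: divide_simps, simp add: algebra_simps)
  qed
  moreover have "1 / 2 \<le> Re (z / (z - a))"
  proof -
    \<comment> \<open>What exceeds 1/2 is half of (z + a)/(z - a), whose real part has the sign of
      |z|^2 - |a|^2.\<close>
    have "z / (z - a) = 1 / 2 + (z + a) / (2 * (z - a))"
      using nz by (simp add: field_simps)
    moreover have "Re ((z + a) / (z - a)) \<ge> 0"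
    proof -
      have "Re ((z + a) * cnj (z - a)) = (norm z)\<^sup>2 - (norm a)\<^sup>2"
        unfolding cmod_power2 by (simp add: algebra_simps power2_eq_square)
      also have "\<dots> \<ge> 0"
        using nz(3) by simp
      finally show ?thesis
        by (subst complex_div_cnj) (simp only: Re_divide_of_real zero_le_divide_iff zero_le_power2
            flip: of_real_power, simp)
    qed
    moreover have "(z + a) / (2 * (z - a)) = ((z + a) / (z - a)) / of_real 2"
      by simp
    ultimately show ?thesis
      by (simp only: Re_divide_of_real plus_complex.simps) simp
  qed
  moreover have "degree ([:- a, 1:] * f) = Suc (degree f)"
    using nz by (simp add: degree_mult_eq del: mult_pCons_left)
  moreover have "degree f / 2 \<le> Re (z * poly (pderiv f) z / poly f z)"
    using root by (auto simp: nz simp del: mult_pCons_left)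
  ultimately show ?case
    by (simp add: field_simps)
qed (auto simp: pderiv_pCons)

text \<open>The values at x and y are compared one linear factor at a time; the leading coefficient
  is common to both sides.\<close>

lemma poly_ratio_le:
  fixes f :: "complex poly"
  assumes "\<And>a. poly f a = 0 \<Longrightarrow> norm (x - a) \<le> C * norm (y - a)"
  shows "norm (poly f x) \<le> C ^ degree f * norm (poly f y)"
  using assms
proof (induction f rule: complex_poly_root_induct)
  case (root a f)
  note False = root(1)
    have "norm (poly f x) \<le> C ^ degree f * norm (poly f y)"
      using root by (auto simp del: mult_pCons_left)
    moreover have "norm (x - a) \<le> C * norm (y - a)"
      using root.prems[of a] by simp
    ultimately have "norm (x - a) * norm (poly f x) \<le>
        (C * norm (y - a)) * (C ^ degree f * norm (poly f y))"
      by (intro mult_mono) (auto intro: order_trans[OF norm_ge_zero])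
    moreover have "degree ([:- a, 1:] * f) = Suc (degree f)"
      using False by (simp add: degree_mult_eq del: mult_pCons_left)
    moreover have "poly ([:- a, 1:] * f) u = (u - a) * poly f u" for u
      by (simp add: algebra_simps)
    ultimately show ?case
      by (simp only: norm_mult power_Suc mult_ac)
qed auto

lemma Fin_in_image_Fin [simp]: "Fin z \<in> Fin ` S \<longleftrightarrow> z \<in> S" "Infty \<notin> Fin ` S"
  by auto

lemma inversion_image: "inversion ` A = inversion -` A"
proof
  show "inversion -` A \<subseteq> inversion ` A"
  proof
    fix y assume "y \<in> inversion -` A"
    then have "inversion (inversion y) \<in> inversion ` A"
      by blast
    then show "y \<in> inversion ` A" by simp
  qed
qed auto

lemma finite_part_in_image:
  assumes "x \<in> Fin ` S" shows "finite_part x \<in> S" "Fin (finite_part x) = x"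
  using assms by auto

section \<open>Normal families\<close>

text \<open>All values lie in one closed disc, on which \<open>Fin\<close> is uniformly continuous,
  so the Euclidean limits of Montel's theorem are spherical limits too.\<close>

lemma uniform_limit_Montel_Fin:
  fixes f :: "nat \<Rightarrow> complex \<Rightarrow> complex"
  assumes hol: "\<And>m. f m holomorphic_on S" and S: "open S"
    and bound: "\<And>m z. z \<in> S \<Longrightarrow> norm (f m z) \<le> B"
  obtains \<rho> g where "strict_mono (\<rho> :: nat \<Rightarrow> nat)"
    "\<And>K. compact K \<Longrightarrow> K \<subseteq> S \<Longrightarrow> uniform_limit K (\<lambda>m z. Fin (f (\<rho> m) z)) g sequentially"
proof -
  have "\<exists>B. \<forall>h\<in>range f. \<forall>z\<in>K. norm (h z) \<le> B" if "compact K" "K \<subseteq> S" for K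
    using that bound by blast
  with S hol obtain g \<rho> where g: "strict_mono (\<rho> :: nat \<Rightarrow> nat)"
      "\<And>x. x \<in> S \<Longrightarrow> (\<lambda>m. f (\<rho> m) x) \<longlonglongrightarrow> g x"
      "\<And>K. compact K \<Longrightarrow> K \<subseteq> S \<Longrightarrow> uniform_limit K (f \<circ> \<rho>) g sequentially"
    by (elim Montel[where \<F> = f and \<H> = "range f"]) auto
  have gb: "norm (g x) \<le> B" if "x \<in> S" for x
    using g(2)[OF that] bound[OF that] by (intro Lim_bounded[OF tendsto_norm]) auto
  have uc: "uniformly_continuous_on (cball 0 B) Fin"
    by (intro compact_uniformly_continuous continuous_on_Fin continuous_on_id) simp
  show ?thesis
  proof (rule that[OF g(1)])
    fix K assume K: "compact K" "K \<subseteq> S"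
    show "uniform_limit K (\<lambda>m z. Fin (f (\<rho> m) z)) (Fin \<circ> g) sequentially"
    proof -
      have "(f \<circ> \<rho>) m ` K \<subseteq> cball 0 B" "g ` K \<subseteq> cball 0 B" for m
        using K(2) bound gb by auto
      then show ?thesis
        using uniform_limit_compose[OF g(3)[OF K] uc] by (simp add: o_def)
    qed
  qed
qed

lemma normal_family_on_inner:
  assumes "\<And>g. g \<in> G \<Longrightarrow> \<exists>q. g = poly_map q \<and> (\<forall>z. norm z < r \<longrightarrow> norm (poly q z) \<le> B)"
  shows "normal_family_on (Fin ` ball 0 r) G"
  unfolding normal_family_on_def
proof (intro allI impI)
  fix s :: "nat \<Rightarrow> rsphere \<Rightarrow> rsphere" assume "range s \<subseteq> G"
  then have "\<forall>m. \<exists>q. s m = poly_map q \<and> (\<forall>z. norm z < r \<longrightarrow> norm (poly q z) \<le> B)"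
    using assms by blast
  then obtain Q where Q: "\<And>m. s m = poly_map (Q m)" "\<And>m z. norm z < r \<Longrightarrow> norm (poly (Q m) z) \<le> B"
    by metis
  obtain \<rho> g where \<rho>: "strict_mono (\<rho> :: nat \<Rightarrow> nat)" and g: "\<And>K. compact K \<Longrightarrow> K \<subseteq> ball 0 r \<Longrightarrow>
      uniform_limit K (\<lambda>m z. Fin (poly (Q (\<rho> m)) z)) g sequentially"
    by (rule uniform_limit_Montel_Fin[of "\<lambda>m. poly (Q m)" "ball 0 r" B])
      (auto intro!: holomorphic_intros Q(2))
  have "uniform_limit K (s \<circ> \<rho>) (\<lambda>x. g (finite_part x)) sequentially"
    if K: "compact K" "K \<subseteq> Fin ` ball 0 r" for K
  proof -
    have "compact (finite_part ` K)"
      by (rule compact_continuous_image[OF continuous_on_subset[OF continuous_on_finite_part]])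
        (use K in auto)
    moreover have "finite_part ` K \<subseteq> ball 0 r"
      using K finite_part_in_image by blast
    ultimately have "uniform_limit K (\<lambda>m x. Fin (poly (Q (\<rho> m)) (finite_part x)))
        (\<lambda>x. g (finite_part x)) sequentially"
      by (intro uniform_limit_compose'[OF g]) auto
    moreover have "Fin (poly (Q m) (finite_part x)) = s m x" if "x \<in> K" for m x
      using K(2) that by (auto simp: Q(1))
    ultimately show ?thesis
      by (simp cong: uniform_limit_cong')
  qed
  with \<rho> show "\<exists>\<rho> f. strict_mono \<rho> \<and> (\<forall>K. compact K \<and> K \<subseteq> Fin ` ball 0 r \<longrightarrow>
      uniform_limit K (s \<circ> \<rho>) f sequentially)"
    by blast
qed

lemma inversion_ball:
  assumes "R > 0"
  shows "inversion ` (- Fin ` cball 0 R) = Fin ` ball 0 (1 / R)"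
proof (rule set_eqI)
  fix x show "x \<in> inversion ` (- Fin ` cball 0 R) \<longleftrightarrow> x \<in> Fin ` ball 0 (1 / R)"
    unfolding inversion_image using assms
    by (cases x) (auto simp: norm_divide divide_simps mult.commute simp del: image_iff)
qed

text \<open>In the chart 1/z on both sides the map is 1/q(1/w) off 0, and continuity on the sphere
  makes the singularity at 0 removable.\<close>

lemma holomorphic_poly_at_Infty:
  assumes R: "R > 0" and q: "degree q \<ge> 1" "\<And>z. norm z \<ge> R \<Longrightarrow> norm (poly q z) > R"
  shows "(\<lambda>w. finite_part (inversion (poly_map q (inversion (Fin w))))) holomorphic_on ball 0 (1 / R)"
    (is "?f holomorphic_on _")
    and "norm w < 1 / R \<Longrightarrow> inversion (poly_map q (inversion (Fin w))) \<in> Fin ` ball 0 (1 / R)"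
proof -
  show im: "inversion (poly_map q (inversion (Fin w))) \<in> Fin ` ball 0 (1 / R)"
    if "norm w < 1 / R" for w
  proof (cases "w = 0")
    case False
    with that R have "norm (1 / w) > R"
      by (simp add: norm_divide divide_simps mult.commute)
    then have "norm (poly q (1 / w)) > R"
      using q(2) by (meson less_imp_le)
    with False R show ?thesis
      by (auto simp: norm_divide divide_simps mult.commute)
  qed (use R in auto)
  show "?f holomorphic_on ball 0 (1 / R)"
  proof (rule no_isolated_singularity[of _ _ "{0}"])
    have "continuous_on UNIV (\<lambda>w. inversion (Fin w))"
      by (intro continuous_on_compose2[OF continuous_on_inversion[of UNIV]] continuous_on_Fin)
        simp_all
    then have "continuous_on UNIV (\<lambda>w. poly_map q (inversion (Fin w)))"
      by (rule continuous_on_compose2[OF continuous_on_poly_map[OF q(1), of UNIV]]) simp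
    then have "continuous_on UNIV (\<lambda>w. inversion (poly_map q (inversion (Fin w))))"
      by (rule continuous_on_compose2[OF continuous_on_inversion[of UNIV]]) simp
    from continuous_on_subset[OF this subset_UNIV]
    show "continuous_on (ball 0 (1 / R)) ?f"
    proof (rule continuous_on_compose2[OF continuous_on_finite_part])
      show "(\<lambda>w. inversion (poly_map q (inversion (Fin w)))) ` ball 0 (1 / R) \<subseteq> range Fin"
      proof (intro image_subsetI)
        fix w :: complex assume "w \<in> ball 0 (1 / R)"
        then have "inversion (poly_map q (inversion (Fin w))) \<in> Fin ` ball 0 (1 / R)"
          by (intro im) simp
        then show "inversion (poly_map q (inversion (Fin w))) \<in> range Fin"
          by blast
      qed
    qed
    have "(\<lambda>w. 1 / poly q (1 / w)) holomorphic_on ball 0 (1 / R) - {0}"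
    proof -
      have "poly q (1 / w) \<noteq> 0" if "w \<in> ball 0 (1 / R) - {0}" for w
        using im[of w] that by (auto split: if_splits)
      moreover have "(\<lambda>w. poly q (1 / w)) holomorphic_on ball 0 (1 / R) - {0}"
        by (rule holomorphic_on_compose_gen[unfolded o_def, of "\<lambda>w. 1 / w" _ "poly q" UNIV])
          (auto intro!: holomorphic_intros)
      ultimately show ?thesis
        by (intro holomorphic_intros) auto
    qed
    then show "?f holomorphic_on ball 0 (1 / R) - {0}"
    proof (rule holomorphic_transform)
      fix w :: complex assume w: "w \<in> ball 0 (1 / R) - {0}"
      with im[of w] show "1 / poly q (1 / w) = ?f w"
        by auto
    qed
  qed auto
qed

text \<open>Conjugation by \<open>inversion\<close> gives holomorphic maps of the disc of radius 1/R
  into itself. Montel's theorem applies there, and limits are carried back because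
  \<open>inversion\<close> is an isometry.\<close>

lemma normal_family_on_outer:
  assumes R: "R > 0"
    and G: "\<And>g. g \<in> G \<Longrightarrow> \<exists>q. g = poly_map q \<and> degree q \<ge> 1 \<and>
      (\<forall>z. norm z \<ge> R \<longrightarrow> norm (poly q z) > R)"
  shows "normal_family_on (- Fin ` cball 0 R) G"
  unfolding normal_family_on_def
proof (intro allI impI)
  fix s :: "nat \<Rightarrow> rsphere \<Rightarrow> rsphere" assume "range s \<subseteq> G"
  then have "\<forall>m. \<exists>q. s m = poly_map q \<and> degree q \<ge> 1 \<and> (\<forall>z. norm z \<ge> R \<longrightarrow> norm (poly q z) > R)"
    using G by blast
  then obtain Q where Q: "\<And>m. s m = poly_map (Q m)" "\<And>m. degree (Q m) \<ge> 1"
      "\<And>m z. norm z \<ge> R \<Longrightarrow> norm (poly (Q m) z) > R"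
    by metis
  define F where "F m w = finite_part (inversion (s m (inversion (Fin w))))" for m w
  have F: "F m holomorphic_on ball 0 (1 / R)"
    "norm w < 1 / R \<Longrightarrow> inversion (s m (inversion (Fin w))) \<in> Fin ` ball 0 (1 / R)" for m w
    unfolding F_def Q(1) using holomorphic_poly_at_Infty[OF R Q(2,3)] by blast+
  have bound: "norm (F m w) \<le> 1 / R" if "w \<in> ball 0 (1 / R)" for m w
    using finite_part_in_image(1)[OF F(2), of w m] that unfolding F_def by simp
  obtain \<rho> g where \<rho>: "strict_mono (\<rho> :: nat \<Rightarrow> nat)" and g: "\<And>K. compact K \<Longrightarrow>
      K \<subseteq> ball 0 (1 / R) \<Longrightarrow> uniform_limit K (\<lambda>m z. Fin (F (\<rho> m) z)) g sequentially"
    by (rule uniform_limit_Montel_Fin[of F, OF F(1) open_ball bound]) (assumption, rule that, assumption+)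
  have "uniform_limit K (s \<circ> \<rho>) (\<lambda>x. inversion (g (finite_part (inversion x)))) sequentially"
    if K: "compact K" "K \<subseteq> - Fin ` cball 0 R" for K
  proof -
    have iK: "inversion ` K \<subseteq> Fin ` ball 0 (1 / R)"
      using K(2) inversion_ball[OF R] by blast
    have "compact (finite_part ` inversion ` K)"
      by (rule compact_continuous_image[OF continuous_on_subset[OF continuous_on_finite_part]
            compact_continuous_image[OF continuous_on_inversion K(1)]])
        (use iK in auto)
    moreover have "finite_part ` inversion ` K \<subseteq> ball 0 (1 / R)"
      using iK finite_part_in_image by blast
    ultimately have "uniform_limit K (\<lambda>m x. Fin (F (\<rho> m) (finite_part (inversion x))))
        (\<lambda>x. g (finite_part (inversion x))) sequentially"
      by (intro uniform_limit_compose'[OF g]) auto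
    then have "uniform_limit K (\<lambda>m x. inversion (Fin (F (\<rho> m) (finite_part (inversion x)))))
        (\<lambda>x. inversion (g (finite_part (inversion x)))) sequentially"
      by (simp only: uniform_limit_iff dist_inversion)
    moreover have "inversion (Fin (F m (finite_part (inversion x)))) = s m x" if "x \<in> K" for m x
    proof -
      have x: "inversion x \<in> Fin ` ball 0 (1 / R)"
        using iK that by blast
      have "norm (finite_part (inversion x)) < 1 / R"
        using finite_part_in_image(1)[OF x] by simp
      from F(2)[OF this, of m] have "inversion (s m x) \<in> Fin ` ball 0 (1 / R)"
        by (simp only: finite_part_in_image(2)[OF x] inversion_inversion)
      from finite_part_in_image(2)[OF this] show ?thesis
        unfolding F_def by (simp only: finite_part_in_image(2)[OF x] inversion_inversion)
    qed
    ultimately show ?thesis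
      by (simp cong: uniform_limit_cong')
  qed
  with \<rho> show "\<exists>\<rho> f. strict_mono \<rho> \<and> (\<forall>K. compact K \<and> K \<subseteq> - Fin ` cball 0 R \<longrightarrow>
      uniform_limit K (s \<circ> \<rho>) f sequentially)"
    by blast
qed

section \<open>Backward invariance of the Fatou set\<close>

text \<open>Associativity regroups a word so that the letter applied first stands alone on the
  right.\<close>

lemma semigroup_gen_cases_right:
  assumes "g \<in> semigroup_gen H"
  obtains "g \<in> H" | h f where "h \<in> H" "f \<in> semigroup_gen H" "g = f \<circ> h"
proof -
  have "g \<in> H \<or> (\<exists>h\<in>H. \<exists>f\<in>semigroup_gen H. g = f \<circ> h)"
    using assms
  proof induction
    case (comp f g)
    then show ?case
      by (metis comp_assoc semigroup_gen.comp)
  qed auto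
  then show ?thesis
    using that by blast
qed

text \<open>As there are finitely many letters, a sequence of words has infinitely many terms with
  the same first letter h. The remaining words form a normal family near h z, and convergence there
  is pulled back by h.\<close>

lemma Fatou_pullback:
  assumes H: "finite H" "\<And>h. h \<in> H \<Longrightarrow> continuous_on UNIV h"
    and z: "\<And>h. h \<in> H \<Longrightarrow> h z \<in> Fatou (semigroup_gen H)"
  shows "z \<in> Fatou (semigroup_gen H)"
proof -
  define G where "G = semigroup_gen H"
  have "\<forall>h\<in>H. \<exists>U. open U \<and> h z \<in> U \<and> normal_family_on U G"
    using z by (auto simp: Fatou_def G_def)
  then obtain U where U: "\<And>h. h \<in> H \<Longrightarrow> open (U h)" "\<And>h. h \<in> H \<Longrightarrow> h z \<in> U h"
      "\<And>h. h \<in> H \<Longrightarrow> normal_family_on (U h) G"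
    by metis
  define V where "V = (\<Inter>h\<in>H. h -` U h)"
  have "open V"
    unfolding V_def using H U(1) by (intro open_INT ballI) (auto simp: continuous_on_open_vimage)
  moreover have "z \<in> V"
    using U(2) by (simp add: V_def)
  moreover have "normal_family_on V G"
    unfolding normal_family_on_def
  proof (intro allI impI)
    fix s :: "nat \<Rightarrow> rsphere \<Rightarrow> rsphere" assume s: "range s \<subseteq> G"
    have "\<forall>m. \<exists>h. h \<in> H \<and> (s m = h \<or> (\<exists>f\<in>G. s m = f \<circ> h))"
    proof
      fix m
      have "s m \<in> semigroup_gen H"
        using s by (auto simp: G_def)
      then show "\<exists>h. h \<in> H \<and> (s m = h \<or> (\<exists>f\<in>G. s m = f \<circ> h))"
        by (cases rule: semigroup_gen_cases_right) (auto simp: G_def)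
    qed
    then obtain \<eta> where \<eta>: "\<And>m. \<eta> m \<in> H" "\<And>m. s m = \<eta> m \<or> (\<exists>f\<in>G. s m = f \<circ> \<eta> m)"
      by metis
    have "finite (range \<eta>)"
      using H(1) \<eta>(1) by (meson finite_subset image_subsetI)
    then obtain m0 where inf: "infinite {m. \<eta> m = \<eta> m0}"
      using pigeonhole_infinite[of UNIV \<eta>] by auto
    define h where "h = \<eta> m0"
    have h: "h \<in> H"
      using \<eta>(1) by (simp add: h_def)
    \<comment> \<open>A word may be the letter h alone; \<open>semigroup_gen\<close> adds no
      identity, so this is a separate case.\<close>
    have eq: "{m. \<eta> m = h} = {m. \<eta> m = h \<and> s m = h} \<union> {m. \<eta> m = h \<and> (\<exists>f\<in>G. s m = f \<circ> h)}"
      using \<eta>(2) by auto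
    from inf consider "infinite {m. \<eta> m = h \<and> s m = h}" | "infinite {m. \<eta> m = h \<and> (\<exists>f\<in>G. s m = f \<circ> h)}"
      unfolding h_def[symmetric] eq finite_Un by blast
    then show "\<exists>\<rho> f. strict_mono \<rho> \<and> (\<forall>K. compact K \<and> K \<subseteq> V \<longrightarrow> uniform_limit K (s \<circ> \<rho>) f sequentially)"
    proof cases
      case 1
      then obtain \<rho> :: "nat \<Rightarrow> nat" where \<rho>: "strict_mono \<rho>" "\<And>m. s (\<rho> m) = h"
        using infinite_enumerate by force
      then have "uniform_limit K (s \<circ> \<rho>) h sequentially" for K
        by (simp add: uniform_limit_iff)
      with \<rho>(1) show ?thesis
        by blast
    next
      case 2
      then obtain \<rho> :: "nat \<Rightarrow> nat" where \<rho>: "strict_mono \<rho>" "\<And>m. \<exists>f\<in>G. s (\<rho> m) = f \<circ> h"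
        using infinite_enumerate by force
      then obtain t where t: "range t \<subseteq> G" "\<And>m. s (\<rho> m) = t m \<circ> h"
        by (metis image_subsetI)
      then obtain \<sigma> f where \<sigma>: "strict_mono \<sigma>"
          "\<And>K. compact K \<Longrightarrow> K \<subseteq> U h \<Longrightarrow> uniform_limit K (t \<circ> \<sigma>) f sequentially"
        using U(3)[OF h] unfolding normal_family_on_def by metis
      have "uniform_limit K (s \<circ> (\<rho> \<circ> \<sigma>)) (\<lambda>x. f (h x)) sequentially" if K: "compact K" "K \<subseteq> V" for K
      proof -
        have "compact (h ` K)"
          using K(1) H(2)[OF h] by (meson compact_continuous_image continuous_on_subset subset_UNIV)
        moreover have "h ` K \<subseteq> U h"
          using K(2) h by (auto simp: V_def)
        ultimately have "uniform_limit K (\<lambda>m x. (t \<circ> \<sigma>) m (h x)) (\<lambda>x. f (h x)) sequentially"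
          by (intro uniform_limit_compose'[OF \<sigma>(2)]) auto
        then show ?thesis
          by (simp add: o_def t(2))
      qed
      with \<rho>(1) \<sigma>(1) show ?thesis
        by (intro exI[of _ "\<rho> \<circ> \<sigma>"]) (auto intro: strict_mono_o)
    qed
  qed
  ultimately show ?thesis
    unfolding Fatou_def G_def by blast
qed

section \<open>The Julia set of an expanding system of polynomials\<close>

text \<open>The setting that the perturbed generators will satisfy. \<open>center\<close> puts a
  whole fibre into the disc, which gives connected preimages; \<open>critical\<close> bounds the
  postcritical set, and \<open>expanding\<close> excludes normality.\<close>

locale annular_system =
  fixes I :: "'i set" and P :: "'i \<Rightarrow> complex poly" and r R :: real
  assumes finite_I: "finite I" and I_nonempty: "I \<noteq> {}"
    and radii: "0 < r" "r < R"
    and degree_P: "i \<in> I \<Longrightarrow> degree (P i) \<ge> 2"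
    and inner: "i \<in> I \<Longrightarrow> norm z \<le> r \<Longrightarrow> norm (poly (P i) z) < r"
    and outer: "i \<in> I \<Longrightarrow> norm z \<ge> R \<Longrightarrow> norm (poly (P i) z) > R"
    and center: "i \<in> I \<Longrightarrow> \<exists>c. norm c \<le> r \<and> (\<forall>z. poly (P i) z = c \<longrightarrow> norm z \<le> r)"
    and critical: "i \<in> I \<Longrightarrow> poly (pderiv (P i)) z = 0 \<Longrightarrow> norm z \<le> r"
    and expanding: "i \<in> I \<Longrightarrow> r \<le> norm (poly (P i) z) \<Longrightarrow> norm (poly (P i) z) \<le> R \<Longrightarrow>
      norm (poly (pderiv (P i)) z) \<ge> 2"
begin

definition maps :: "(rsphere \<Rightarrow> rsphere) set" where
  "maps = (\<lambda>i. poly_map (P i)) ` I"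

definition G :: "(rsphere \<Rightarrow> rsphere) set" where
  "G = semigroup_gen maps"

definition annulus :: "complex set" where
  "annulus = cball 0 R - ball 0 r"

text \<open>\<open>level k\<close> is the set \<open>W\<^sub>k\<close>; the recursion peels off the
  letter applied first.\<close>

fun level :: "nat \<Rightarrow> complex set" where
  "level 0 = annulus"
| "level (Suc k) = (\<Union>i\<in>I. poly (P i) -` level k)"

lemma G_cases:
  assumes "g \<in> G"
  obtains q where "g = poly_map q" "degree q \<ge> 2"
    "\<And>z. norm z \<le> r \<Longrightarrow> norm (poly q z) < r" "\<And>z. norm z \<ge> R \<Longrightarrow> norm (poly q z) > R"
    "\<And>z. poly (pderiv q) z = 0 \<Longrightarrow> norm (poly q z) \<le> r"
proof -
  have "\<exists>q. g = poly_map q \<and> degree q \<ge> 2 \<and> (\<forall>z. norm z \<le> r \<longrightarrow> norm (poly q z) < r) \<and>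
    (\<forall>z. norm z \<ge> R \<longrightarrow> norm (poly q z) > R) \<and>
    (\<forall>z. poly (pderiv q) z = 0 \<longrightarrow> norm (poly q z) \<le> r)"
    using assms unfolding G_def
  proof induction
    case (gen h)
    then obtain i where "i \<in> I" "h = poly_map (P i)"
      by (auto simp: maps_def)
    then show ?case
      using degree_P inner outer critical by (intro exI[of _ "P i"]) (auto intro: less_imp_le)
  next
    case (comp f g)
    from comp.IH obtain p q where p: "f = poly_map p" "degree p \<ge> 2"
        "\<And>z. norm z \<le> r \<Longrightarrow> norm (poly p z) < r" "\<And>z. norm z \<ge> R \<Longrightarrow> norm (poly p z) > R"
        "\<And>z. poly (pderiv p) z = 0 \<Longrightarrow> norm (poly p z) \<le> r"
      and q: "g = poly_map q" "degree q \<ge> 2"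
        "\<And>z. norm z \<le> r \<Longrightarrow> norm (poly q z) < r" "\<And>z. norm z \<ge> R \<Longrightarrow> norm (poly q z) > R"
        "\<And>z. poly (pderiv q) z = 0 \<Longrightarrow> norm (poly q z) \<le> r"
      by blast
    have "2 * 1 \<le> degree p * degree q"
      using p(2) q(2) by (intro mult_mono) auto
    \<comment> \<open>By the chain rule a critical point of the composition is critical for q or is
      mapped by q to a critical point of p. In the first case p keeps the critical value of q in the
      disc.\<close>
    then show ?case
      using p(1,2,5) q(1,2,5) p(3)[OF less_imp_le[OF q(3)]] p(4)[OF less_imp_le[OF q(4)]]
        p(3)[OF q(5)]
      by (intro exI[of _ "pcompose p q"])
        (auto simp: poly_map_comp poly_pcompose pderiv_pcompose degree_pcompose less_imp_le)
  qed
  then show ?thesis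
    using that by blast
qed

lemma maps_subset_Poly_maps: "maps \<subseteq> Poly_maps"
  using degree_P by (fastforce simp: maps_def Poly_maps_def)

lemma G_in_class_G: "G \<in> class_G"
proof -
  have "polynomial_semigroup G"
    unfolding polynomial_semigroup_def G_def
    using I_nonempty maps_subset_Poly_maps by (intro exI[of _ maps]) (auto simp: maps_def)
  moreover have "\<exists>p. degree p \<ge> 2 \<and> g = poly_map p" if "g \<in> G" for g
    using that by (rule G_cases) blast
  moreover have "bounded (Fin -` postcritical_star G)"
  proof -
    \<comment> \<open>The set on the right is the closed disc together with \<open>Infty\<close>. It
      allows for the critical value \<open>Infty\<close> and is closed on the sphere.\<close>
    have "critical_values g \<subseteq> - Fin ` (- cball 0 r)" if "g \<in> G" for g
    proof
      fix y assume "y \<in> critical_values g"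
      then obtain p where p: "critical_point g p" "y = g p"
        by (auto simp: critical_values_def)
      obtain q where q: "g = poly_map q" "\<And>z. poly (pderiv q) z = 0 \<Longrightarrow> norm (poly q z) \<le> r"
        using \<open>g \<in> G\<close> by (rule G_cases) blast
      show "y \<in> - Fin ` (- cball 0 r)"
        using p q by (cases p) (auto simp: critical_point_Fin)
    qed
    moreover have "closed (- Fin ` (- cball 0 r))"
      by (intro closed_Compl open_Fin_image) auto
    ultimately have "postcritical G \<subseteq> - Fin ` (- cball 0 r)"
      unfolding postcritical_def by (intro closure_minimal) auto
    then have "Fin -` postcritical_star G \<subseteq> cball 0 r"
      by (fastforce simp: postcritical_star_def)
    then show ?thesis
      using bounded_cball bounded_subset by blast
  qed
  ultimately show ?thesis
    by (simp add: class_G_def)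
qed

lemma annulus_vimage: "i \<in> I \<Longrightarrow> poly (P i) z \<in> annulus \<Longrightarrow> z \<in> annulus"
  using inner[of i z] outer[of i z] by (force simp: annulus_def)

lemma level_Suc_subset: "level (Suc k) \<subseteq> level k"
proof (induction k)
  case 0
  then show ?case
    using annulus_vimage by auto
next
  case (Suc k)
  then show ?case
    by (subst (1 2) level.simps) blast
qed

lemma level_antimono: "k \<le> m \<Longrightarrow> level m \<subseteq> level k"
  by (rule lift_Suc_antimono_le[of level, OF level_Suc_subset])

lemma compact_level: "compact (level k)"
proof (induction k)
  case 0
  then show ?case
    by (simp add: annulus_def compact_diff)
next
  case (Suc k)
  then show ?case
    using finite_I degree_P compact_poly_vimage by fastforce
qed

lemma Infty_in_Fatou: "Infty \<in> Fatou G" and outer_in_Fatou: "norm z > R \<Longrightarrow> Fin z \<in> Fatou G"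
proof -
  have "normal_family_on (- Fin ` cball 0 R) G"
  proof (rule normal_family_on_outer)
    fix g assume "g \<in> G"
    then show "\<exists>q. g = poly_map q \<and> degree q \<ge> 1 \<and> (\<forall>z. norm z \<ge> R \<longrightarrow> norm (poly q z) > R)"
      by (rule G_cases) (metis one_le_numeral order_trans)
  qed (use radii in auto)
  moreover have "open (- Fin ` cball 0 R)"
    by (intro open_complement_Fin_image compact_cball)
  ultimately show "Infty \<in> Fatou G" "norm z > R \<Longrightarrow> Fin z \<in> Fatou G"
    unfolding Fatou_def by (auto intro!: exI[of _ "- Fin ` cball 0 R"])
qed

lemma inner_in_Fatou: "norm z < r \<Longrightarrow> Fin z \<in> Fatou G"
proof -
  have "normal_family_on (Fin ` ball 0 r) G"
  proof (rule normal_family_on_inner[of _ _ r])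
    fix g assume "g \<in> G"
    then show "\<exists>q. g = poly_map q \<and> (\<forall>z. norm z < r \<longrightarrow> norm (poly q z) \<le> r)"
      by (rule G_cases) (intro exI conjI, auto intro: less_imp_le)
  qed
  moreover have "open (Fin ` ball 0 r)"
    by (intro open_Fin_image open_ball)
  ultimately show "norm z < r \<Longrightarrow> Fin z \<in> Fatou G"
    unfolding Fatou_def by (auto intro!: exI[of _ "Fin ` ball 0 r"])
qed

text \<open>Off the annulus the two normality lemmas apply. \<open>Fatou_pullback\<close> carries
  this back one letter per level, since no generator maps z into the preceding level.\<close>

lemma not_level_in_Fatou: "z \<notin> level k \<Longrightarrow> Fin z \<in> Fatou G"
proof (induction k arbitrary: z)
  case 0
  then show ?case
    using inner_in_Fatou outer_in_Fatou by (force simp: annulus_def)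
next
  case (Suc k)
  show ?case
    unfolding G_def
  proof (rule Fatou_pullback)
    show "finite maps"
      using finite_I by (simp add: maps_def)
    fix h assume "h \<in> maps"
    then obtain i where i: "i \<in> I" "h = poly_map (P i)"
      by (auto simp: maps_def)
    then show "continuous_on UNIV h"
      using degree_P continuous_on_poly_map by fastforce
    have "poly (P i) z \<notin> level k"
      using Suc.prems i(1) by auto
    then show "h (Fin z) \<in> Fatou (semigroup_gen maps)"
      using Suc.IH i(2) by (simp add: G_def)
  qed
qed

section \<open>Expansion excludes normality\<close>

text \<open>All images of z along the word lie in the annulus, so by the chain rule each of its k +
  1 letters contributes a factor of at least 2.\<close>

lemma large_derivative:
  assumes "z \<in> level (Suc k)"
  shows "\<exists>q. poly_map q \<in> G \<and> poly q z \<in> annulus \<and> norm (poly (pderiv q) z) \<ge> 2 ^ Suc k"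
  using assms
proof (induction k arbitrary: z)
  case 0
  then obtain i where i: "i \<in> I" "poly (P i) z \<in> annulus"
    by auto
  moreover from this have "poly_map (P i) \<in> G"
    by (auto simp: G_def maps_def intro: semigroup_gen.gen)
  ultimately show ?case
    using expanding[of i z] by (auto simp: annulus_def)
next
  case (Suc k)
  then obtain i where i: "i \<in> I" and z: "poly (P i) z \<in> level (Suc k)"
    unfolding level.simps(2)[of "Suc k"] by blast
  from Suc.IH[OF z] obtain q where q: "poly_map q \<in> G" "poly q (poly (P i) z) \<in> annulus"
      "norm (poly (pderiv q) (poly (P i) z)) \<ge> 2 ^ Suc k"
    by blast
  have "poly (P i) z \<in> annulus"
    using z level_antimono[of 0 "Suc k"] by auto
  then have "norm (poly (pderiv (P i)) z) \<ge> 2"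
    using expanding[OF i] by (simp add: annulus_def)
  with q(3) have "2 ^ Suc k * 2 \<le> norm (poly (pderiv q) (poly (P i) z)) * norm (poly (pderiv (P i)) z)"
    by (intro mult_mono) auto
  moreover have "poly_map (P i) \<in> G"
    using i by (auto simp: G_def maps_def intro: semigroup_gen.gen)
  then have "poly_map (pcompose q (P i)) \<in> G"
    using q(1) semigroup_gen.comp unfolding G_def by (metis poly_map_comp)
  ultimately show ?case
    using q(2) by (intro exI[of _ "pcompose q (P i)"])
      (simp add: poly_pcompose pderiv_pcompose norm_mult mult.commute)
qed

text \<open>A convergent subsequence of words would be bounded near z, since the values at z stay in
  the annulus. Cauchy's estimate then bounds derivatives that grow at least like 2^k.\<close>

lemma level_Inter_not_in_Fatou:
  assumes z: "\<And>k. z \<in> level k"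
  shows "Fin z \<notin> Fatou G"
proof
  assume "Fin z \<in> Fatou G"
  then obtain U where U: "open U" "Fin z \<in> U" "normal_family_on U G"
    by (auto simp: Fatou_def)
  obtain Q where Q: "\<And>k. poly_map (Q k) \<in> G" "\<And>k. poly (Q k) z \<in> annulus"
      "\<And>k. norm (poly (pderiv (Q k)) z) \<ge> 2 ^ Suc k"
    using large_derivative[OF z] by metis
  have "range (\<lambda>k. poly_map (Q k)) \<subseteq> G"
    using Q(1) by blast
  from U(3)[unfolded normal_family_on_def, THEN spec, THEN mp, OF this] obtain \<rho> f where \<rho>: "strict_mono \<rho>" and f: "\<And>K. compact K \<Longrightarrow> K \<subseteq> U \<Longrightarrow>
      uniform_limit K ((\<lambda>k. poly_map (Q k)) \<circ> \<rho>) f sequentially"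
    by blast
  obtain d where d: "d > 0" "cball (Fin z) d \<subseteq> U"
    using U open_contains_cball by blast
  have "compact (cball (Fin z) d)"
    using compact_Int_closed[OF compact_rsphere_UNIV closed_cball] by simp
  from f[OF this d(2)]
  have lim: "uniform_limit (cball (Fin z) d) (\<lambda>k. poly_map (Q (\<rho> k))) f sequentially"
    by (simp add: o_def)
  have "compact annulus" "annulus \<subseteq> ball 0 (R + 1)"
    using compact_level[of 0] by (auto simp: annulus_def)
  then obtain \<kappa> where \<kappa>: "\<kappa> > 0"
      "\<And>u q. u \<in> annulus \<Longrightarrow> dist (Fin u) q < \<kappa> \<Longrightarrow> q \<in> Fin ` ball 0 (R + 1)"
    by (rule finite_compact_nhd[OF _ open_ball]) (rule that, assumption+)
  \<comment> \<open>One fifth for each of the five distances along s m z, f z, s M z, s M x, f x, s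
    m x; continuity of the single map s M controls the middle one.\<close>
  from \<kappa>(1) have "\<kappa> / 5 > 0" by simp
  from uniform_limitD[OF lim this] obtain M where M: "\<And>m x. m \<ge> M \<Longrightarrow> x \<in> cball (Fin z) d \<Longrightarrow>
      dist (poly_map (Q (\<rho> m)) x) (f x) < \<kappa> / 5"
    unfolding eventually_sequentially by blast
  obtain q2 where "poly_map (Q (\<rho> M)) = poly_map q2" "degree q2 \<ge> 2"
    using Q(1)[of "\<rho> M"] by (rule G_cases)
  then have "continuous_on UNIV (poly_map (Q (\<rho> M)))"
    using continuous_on_poly_map[of q2 UNIV] by simp
  then obtain d' where d': "d' > 0"
      "\<And>x. dist x (Fin z) < d' \<Longrightarrow> dist (poly_map (Q (\<rho> M)) x) (poly_map (Q (\<rho> M)) (Fin z)) < \<kappa> / 5"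
    using \<open>\<kappa> / 5 > 0\<close> unfolding continuous_on_iff by blast
  have "open (Fin -` ball (Fin z) (min d d'))"
    by (intro open_Fin_vimage open_ball)
  moreover have "z \<in> Fin -` ball (Fin z) (min d d')"
    using d(1) d'(1) by simp
  ultimately obtain e where e: "e > 0" "cball z e \<subseteq> Fin -` ball (Fin z) (min d d')"
    using open_contains_cball by blast
  have bound: "norm (poly (Q (\<rho> m)) x) \<le> R + 1" if m: "m \<ge> M" and x: "x \<in> cball z e" for m x
  proof -
    have x': "dist (Fin x) (Fin z) < d'" "Fin x \<in> cball (Fin z) d" "Fin z \<in> cball (Fin z) d"
      using e(2) x d(1) by (auto simp: subset_iff dist_commute)
    define s where "s k = poly_map (Q (\<rho> k))" for k
    have "dist (s m (Fin z)) (s m (Fin x)) \<le> dist (s m (Fin z)) (f (Fin z)) + dist (s M (Fin z)) (f (Fin z)) +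
        dist (s M (Fin x)) (s M (Fin z)) + dist (s M (Fin x)) (f (Fin x)) + dist (s m (Fin x)) (f (Fin x))"
      using dist_triangle2[of "s m (Fin z)" "s M (Fin z)" "f (Fin z)"]
        dist_triangle2[of "s m (Fin z)" "s M (Fin x)" "s M (Fin z)"]
        dist_triangle[of "s m (Fin z)" "f (Fin x)" "s M (Fin x)"]
        dist_triangle2[of "s m (Fin z)" "s m (Fin x)" "f (Fin x)"] by linarith
    also have "\<dots> < \<kappa>"
      using M[OF m x'(2)] M[OF m x'(3)] M[OF order_refl x'(2)] M[OF order_refl x'(3)] d'(2)[OF x'(1)]
      by (simp add: s_def)
    finally have "dist (Fin (poly (Q (\<rho> m)) z)) (Fin (poly (Q (\<rho> m)) x)) < \<kappa>"
      by (simp add: s_def)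
    from \<kappa>(2)[OF Q(2) this] show ?thesis
      by simp
  qed
  have "2 ^ m \<le> (R + 1) / e" if m: "m \<ge> M" for m
  proof -
    have "norm ((deriv ^^ 1) (poly (Q (\<rho> m))) z) \<le> fact 1 * (R + 1) / e ^ 1"
      by (rule Cauchy_inequality)
        (use e(1) bound[OF m] in \<open>auto intro!: holomorphic_intros continuous_intros simp: dist_norm\<close>)
    moreover have "deriv (poly (Q (\<rho> m))) z = poly (pderiv (Q (\<rho> m))) z"
      by (intro DERIV_imp_deriv poly_DERIV)
    moreover have "(2::real) ^ m \<le> 2 ^ Suc (\<rho> m)"
      using seq_suble[OF \<rho>, of m] by (intro power_increasing) auto
    ultimately show ?thesis
      using Q(3)[of "\<rho> m"] by simp
  qed
  moreover obtain N where "(R + 1) / e < 2 ^ N"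
    using real_arch_pow[of 2 "(R + 1) / e"] by auto
  moreover have "(2::real) ^ N \<le> 2 ^ max M N"
    by (intro power_increasing) auto
  ultimately show False
    by (meson max.cobounded1 not_le order_trans)
qed

lemma Julia_eq: "Julia G = Fin ` (\<Inter>k. level k)"
proof (rule set_eqI)
  fix x show "x \<in> Julia G \<longleftrightarrow> x \<in> Fin ` (\<Inter>k. level k)"
    using not_level_in_Fatou level_Inter_not_in_Fatou Infty_in_Fatou
    by (cases x) (auto simp: Julia_def simp del: level.simps)
qed

end

section \<open>Connectedness of the Julia set\<close>

text \<open>Finiteness makes the union of the other members closed, so a connected subset of the
  whole that contains \<open>C j\<close> cannot reach them.\<close>

lemma components_Union_disjoint_closed:
  fixes C :: "'j \<Rightarrow> 'a::metric_space set"
  assumes fin: "finite J" and C: "\<And>j. j \<in> J \<Longrightarrow> closed (C j)" "\<And>j. j \<in> J \<Longrightarrow> connected (C j)"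
      "\<And>j. j \<in> J \<Longrightarrow> C j \<noteq> {}" and disj: "disjoint_family_on C J"
  shows "card (components (\<Union>j\<in>J. C j)) = card J"
proof -
  have comp: "C j \<in> components (\<Union>j\<in>J. C j)" if j: "j \<in> J" for j
    unfolding in_components_maximal
  proof (intro conjI allI impI)
    fix D assume D: "D \<noteq> {} \<and> C j \<subseteq> D \<and> D \<subseteq> (\<Union>j\<in>J. C j) \<and> connected D"
    define X where "X = (\<Union>i\<in>J - {j}. C i)"
    have "closed X"
      unfolding X_def using fin C by (intro closed_UN) auto
    moreover have "C j \<inter> X = {}"
      unfolding X_def using disj j by (auto simp: disjoint_family_on_def)
    moreover have "D \<subseteq> C j \<union> X"
      unfolding X_def using D by blast
    ultimately have "D \<inter> X = {}"
      using connected_closedD[of D "C j" X] C(1,3)[OF j] D by blast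
    then show "D = C j"
      using D \<open>D \<subseteq> C j \<union> X\<close> by blast
  qed (use C j in auto)
  have "components (\<Union>j\<in>J. C j) = C ` J"
  proof
    show "components (\<Union>j\<in>J. C j) \<subseteq> C ` J"
    proof
      fix K assume K: "K \<in> components (\<Union>j\<in>J. C j)"
      then obtain x where "x \<in> K"
        using in_components_nonempty by blast
      moreover from this obtain j where "j \<in> J" "x \<in> C j"
        using in_components_subset[OF K] by blast
      ultimately show "K \<in> C ` J"
        using components_eq[OF K comp] by blast
    qed
  qed (use comp in blast)
  moreover have "inj_on C J"
    using C(3) disj unfolding inj_on_def disjoint_family_on_def by (metis Int_absorb)
  ultimately show ?thesis
    by (simp add: card_image)
qed

section \<open>Preimages of the annulus under single words\<close>

context annular_system
begin

text \<open>The words are kept apart because connectedness is proved for one word at a time.\<close>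

fun pieces :: "nat \<Rightarrow> complex set set" where
  "pieces 0 = {annulus}"
| "pieces (Suc k) = (\<Union>i\<in>I. (\<lambda>E. poly (P i) -` E) ` pieces k)"

lemma level_eq_Union_pieces: "level k = \<Union> (pieces k)"
  by (induction k) auto

lemma pieces_nonempty: "pieces k \<noteq> {}"
  using I_nonempty by (induction k) auto

text \<open>Separation of the disc from the exterior, phrased with connected test sets so that it
  passes to preimages: by \<open>inner\<close> and \<open>outer\<close> the image of a test set is
  again one.\<close>

definition essential :: "complex set \<Rightarrow> bool" where
  "essential E \<longleftrightarrow>
    (\<forall>T. connected T \<longrightarrow> (\<exists>z\<in>T. norm z \<le> r) \<longrightarrow> (\<exists>z\<in>T. norm z \<ge> R) \<longrightarrow> T \<inter> E \<noteq> {})"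

lemma essential_annulus: "essential annulus"
  unfolding essential_def
proof (intro allI impI)
  fix T :: "complex set" assume T: "connected T" "\<exists>z\<in>T. norm z \<le> r" "\<exists>z\<in>T. norm z \<ge> R"
  have "connected (norm ` T)"
    by (intro connected_continuous_image continuous_intros T)
  then have "r \<in> norm ` T"
    using T(2,3) radii unfolding connected_iff_interval by fastforce
  then show "T \<inter> annulus \<noteq> {}"
    using radii by (auto simp: annulus_def)
qed

lemma essential_vimage:
  assumes "i \<in> I" "essential E"
  shows "essential (poly (P i) -` E)"
  unfolding essential_def
proof (intro allI impI)
  fix T :: "complex set" assume T: "connected T" "\<exists>z\<in>T. norm z \<le> r" "\<exists>z\<in>T. norm z \<ge> R"
  have "connected (poly (P i) ` T)"
    by (intro connected_continuous_image continuous_intros T)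
  moreover have "\<exists>w\<in>poly (P i) ` T. norm w \<le> r" "\<exists>w\<in>poly (P i) ` T. norm w \<ge> R"
    using T(2,3) inner[OF assms(1)] outer[OF assms(1)] less_imp_le by blast+
  ultimately have "poly (P i) ` T \<inter> E \<noteq> {}"
    using assms(2) unfolding essential_def by blast
  then show "T \<inter> poly (P i) -` E \<noteq> {}"
    by blast
qed

lemma essential_pieces: "E \<in> pieces k \<Longrightarrow> essential E"
  by (induction k arbitrary: E) (auto simp: essential_annulus essential_vimage)

lemma connected_outer: "connected (- ball (0::complex) x)"
  by (intro connected_complement_bounded_convex) auto

text \<open>A piece is \<open>{r \<le> |g| \<le> R}\<close> for a word \<open>g\<close>. The connectedness of \<open>{r \<le> |g|}\<close> and of
  \<open>{|g| \<le> R}\<close> passes to preimages, and the plane is unicoherent.\<close>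

lemma connected_pieces:
  assumes "E \<in> pieces k"
  shows "connected E"
proof -
  \<comment> \<open>The last two inclusions persist under preimages. They supply the connected set
    containing a whole fibre that \<open>connected_poly_vimage\<close> asks for.\<close>
  have "\<exists>S T. E = S \<inter> T \<and> S \<union> T = UNIV \<and> closed S \<and> connected S \<and> closed T \<and> connected T \<and>
      - ball 0 R \<subseteq> S \<and> cball 0 r \<subseteq> T"
    using assms
  proof (induction k arbitrary: E)
    case 0
    show ?case
    proof (intro exI conjI)
      show "E = - ball 0 r \<inter> cball 0 R"
        using 0 by (auto simp: annulus_def)
      show "- ball 0 r \<union> cball 0 R = UNIV" "- ball 0 R \<subseteq> - ball 0 r" "cball 0 r \<subseteq> cball 0 R"
        using radii(2) by auto
    qed (simp_all add: connected_outer closed_Compl)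
  next
    case (Suc k)
    then obtain i F where i: "i \<in> I" and F: "F \<in> pieces k" "E = poly (P i) -` F"
      by auto
    obtain S T where ST: "F = S \<inter> T" "S \<union> T = UNIV" "closed S" "connected S" "closed T" "connected T"
        "- ball 0 R \<subseteq> S" "cball 0 r \<subseteq> T"
      using Suc.IH[OF F(1)] by blast
    have deg: "degree (P i) \<ge> 1"
      using degree_P[OF i] by simp
    have sub: "- ball 0 R \<subseteq> poly (P i) -` S" "cball 0 r \<subseteq> poly (P i) -` T"
    proof -
      have "poly (P i) z \<in> - ball 0 R" if "z \<in> - ball 0 R" for z
        using outer[OF i, of z] that by simp
      then show "- ball 0 R \<subseteq> poly (P i) -` S"
        using ST(7) by blast
      have "poly (P i) z \<in> cball 0 r" if "z \<in> cball 0 r" for z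
        using inner[OF i, of z] that by simp
      then show "cball 0 r \<subseteq> poly (P i) -` T"
        using ST(8) by blast
    qed
    obtain c where c: "norm c \<le> r" "\<And>z. poly (P i) z = c \<Longrightarrow> norm z \<le> r"
      using center[OF i] by blast
    have "connected (poly (P i) -` T)"
      by (rule connected_poly_vimage[OF deg ST(6,5) _ sub(2), of c]) (use c ST(8) in auto)
    moreover have "connected (poly (P i) -` S)"
    proof -
      have "bounded (poly (P i) ` cball 0 R)"
        by (intro compact_imp_bounded compact_continuous_image continuous_intros compact_cball)
      then obtain B where "\<forall>x\<in>poly (P i) ` cball 0 R. norm x \<le> B"
        unfolding bounded_iff by blast
      then have B: "norm (poly (P i) z) \<le> B" if "norm z \<le> R" for z
        using that by simp
      \<comment> \<open>Larger than every value of \<open>P i\<close> on the disc of radius R, so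
        that the fibre over d lies in the connected exterior.\<close>
      define d :: complex where "d = of_real (max R (B + 1))"
      have d: "norm d \<ge> R" "norm d > B"
        using radii by (simp_all add: d_def)
      have fibre: "poly (P i) -` {d} \<subseteq> - ball 0 R"
      proof
        fix z assume "z \<in> poly (P i) -` {d}"
        then show "z \<in> - ball 0 R"
          using B[of z] d(2) by (cases "norm z \<le> R") auto
      qed
      show ?thesis
        by (rule connected_poly_vimage[OF deg ST(4,3) connected_outer sub(1) _ fibre])
          (use d(1) ST(7) in auto)
    qed
    moreover have "E = poly (P i) -` S \<inter> poly (P i) -` T" "poly (P i) -` S \<union> poly (P i) -` T = UNIV"
      using F(2) ST(1,2) by auto
    ultimately show ?case
      using sub closed_poly_vimage[OF ST(3)] closed_poly_vimage[OF ST(5)] by metis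
  qed
  then obtain S T where ST: "E = S \<inter> T" "S \<union> T = UNIV" "closed S" "connected S" "closed T" "connected T"
    by blast
  show ?thesis
    unfolding ST(1) by (rule unicoherentD[OF unicoherent_UNIV]) (use ST in auto)
qed

end

text \<open>\<open>left\<close> and \<open>right\<close> say that the preimage of the annulus under \<open>P\<^sub>n\<^sub>+\<^sub>j\<close> meets the real axis
  inside the circle belonging to \<open>P\<^sub>j\<close> on the left and outside it on the right.\<close>

locale linked_system = annular_system I P r R for I :: "nat set" and P and r R +
  fixes n :: nat and A :: "nat \<Rightarrow> complex set"
  assumes I_eq: "I = {1..2 * n}" and A_disjoint: "disjoint_family_on A {1..n}"
    and vimage_subset_A: "j \<in> {1..n} \<Longrightarrow> poly (P j) z \<in> annulus \<Longrightarrow> z \<in> A j"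
      "j \<in> {1..n} \<Longrightarrow> poly (P (n + j)) z \<in> annulus \<Longrightarrow> z \<in> A j"
    and left: "j \<in> {1..n} \<Longrightarrow> x \<ge> 0 \<Longrightarrow> poly (P (n + j)) (- of_real x) \<in> annulus \<Longrightarrow>
      norm (poly (P j) (- of_real x)) \<le> r"
    and right: "j \<in> {1..n} \<Longrightarrow> x \<ge> 0 \<Longrightarrow> poly (P (n + j)) (of_real x) \<in> annulus \<Longrightarrow>
      norm (poly (P j) (of_real x)) \<ge> R"
begin

section \<open>Linking, and the bands near each radius\<close>

definition band :: "nat \<Rightarrow> nat \<Rightarrow> complex set" where
  "band j k = poly (P j) -` level k \<union> poly (P (n + j)) -` level k"

lemma meets_ray:
  assumes "essential E" "norm u = 1"
  obtains x where "x \<ge> 0" "of_real x * u \<in> E"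
proof -
  have "connected ((\<lambda>x. of_real x * u) ` {0..})"
    by (intro connected_continuous_image continuous_intros) simp
  moreover have "\<exists>z\<in>(\<lambda>x. of_real x * u) ` {0..}. norm z \<le> r" "\<exists>z\<in>(\<lambda>x. of_real x * u) ` {0..}. norm z \<ge> R"
  proof -
    show "\<exists>z\<in>(\<lambda>x. of_real x * u) ` {0..}. norm z \<le> r"
      using radii by (intro bexI[of _ 0]) (auto intro: image_eqI[of _ _ 0])
    show "\<exists>z\<in>(\<lambda>x. of_real x * u) ` {0..}. norm z \<ge> R"
      using radii assms(2) by (intro bexI[of _ "of_real R * u"]) (auto simp: norm_mult)
  qed
  ultimately have "(\<lambda>x. of_real x * u) ` {0..} \<inter> E \<noteq> {}"
    using assms(1) unfolding essential_def by blast
  with that show ?thesis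
    by auto
qed

text \<open>The preimage of F is connected and meets both half-axes, on the left where
  \<open>P j\<close> takes values in the disc and on the right where they lie in the exterior. Its
  image under \<open>P j\<close> thus joins disc and exterior and must meet E.\<close>

lemma pieces_linked:
  assumes j: "j \<in> {1..n}" and E: "E \<in> pieces k" "F \<in> pieces k"
  shows "poly (P j) -` E \<inter> poly (P (n + j)) -` F \<noteq> {}"
proof -
  define Y where "Y = poly (P (n + j)) -` F"
  have I: "n + j \<in> I"
    using j by (auto simp: I_eq)
  have Y: "Y \<in> pieces (Suc k)"
    using I E(2) by (auto simp: Y_def)
  have ann: "poly (P (n + j)) z \<in> annulus" if "z \<in> Y" for z
    using that E(2) level_antimono[of 0 k] by (auto simp: Y_def level_eq_Union_pieces)
  obtain x where x: "x \<ge> 0" "of_real x * (- 1) \<in> Y"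
    using meets_ray[OF essential_pieces[OF Y], of "- 1"] by auto
  obtain y where y: "y \<ge> 0" "of_real y * 1 \<in> Y"
    using meets_ray[OF essential_pieces[OF Y], of 1] by auto
  have "connected (poly (P j) ` Y)"
    by (intro connected_continuous_image continuous_intros connected_pieces[OF Y])
  moreover have "\<exists>z\<in>poly (P j) ` Y. norm z \<le> r"
    using left[OF j x(1)] x(2) ann[OF x(2)] by auto
  moreover have "\<exists>z\<in>poly (P j) ` Y. norm z \<ge> R"
    using right[OF j y(1)] y(2) ann[OF y(2)] by auto
  ultimately have "poly (P j) ` Y \<inter> E \<noteq> {}"
    using essential_pieces[OF E(1)] unfolding essential_def by blast
  then show ?thesis
    by (auto simp: Y_def)
qed

lemma connected_band:
  assumes j: "j \<in> {1..n}"
  shows "connected (band j k)"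
proof -
  obtain E0 where E0: "E0 \<in> pieces k"
    using pieces_nonempty by blast
  have I: "j \<in> I" "n + j \<in> I"
    using j by (auto simp: I_eq)
  have conn: "connected (poly (P j) -` E)" "connected (poly (P (n + j)) -` E)" if "E \<in> pieces k" for E
    using that I by (intro connected_pieces[of _ "Suc k"]; force)+
  define Z where "Z E F = poly (P j) -` E \<union> poly (P (n + j)) -` F" for E F
  have Z: "connected (Z E F)" if "E \<in> pieces k" "F \<in> pieces k" for E F
    unfolding Z_def using that conn pieces_linked[OF j] by (intro connected_Un) auto
  \<comment> \<open>Linking only joins a preimage under \<open>P j\<close> to one under
    \<open>P (n + j)\<close>. The fixed piece \<open>E0\<close> is the bridge: every member of
    \<open>ZZ\<close> contains a common point of its two preimages.\<close>
  define ZZ where "ZZ = (\<lambda>(E, F). Z E E0 \<union> Z E0 F) ` (pieces k \<times> pieces k)"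
  have "connected (\<Union> ZZ)"
  proof (rule connected_Union)
    fix S assume "S \<in> ZZ"
    then obtain E F where EF: "E \<in> pieces k" "F \<in> pieces k" "S = Z E E0 \<union> Z E0 F"
      by (auto simp: ZZ_def)
    have "Z E E0 \<inter> Z E0 F \<noteq> {}"
      using pieces_linked[OF j E0 E0] by (auto simp: Z_def)
    then show "connected S"
      unfolding EF(3) using EF Z E0 by (intro connected_Un) auto
  next
    show "\<Inter> ZZ \<noteq> {}"
      using pieces_linked[OF j E0 E0] by (auto simp: ZZ_def Z_def)
  qed
  moreover have "\<Union> ZZ = band j k"
    unfolding ZZ_def Z_def band_def level_eq_Union_pieces using E0 by fastforce
  ultimately show ?thesis
    by simp
qed

lemma band_nonempty: "j \<in> {1..n} \<Longrightarrow> band j k \<noteq> {}"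
proof -
  assume j: "j \<in> {1..n}"
  obtain E where E: "E \<in> pieces k"
    using pieces_nonempty by blast
  show ?thesis
    using pieces_linked[OF j E E] E unfolding band_def level_eq_Union_pieces by blast
qed

lemma compact_band: "j \<in> {1..n} \<Longrightarrow> compact (band j k)"
proof -
  assume "j \<in> {1..n}"
  then have "degree (P j) \<ge> 2" "degree (P (n + j)) \<ge> 2"
    by (auto intro: degree_P simp: I_eq)
  then show ?thesis
    unfolding band_def by (intro compact_Un compact_poly_vimage compact_level) auto
qed

lemma band_antimono: "k \<le> m \<Longrightarrow> band j m \<subseteq> band j k"
  using level_antimono[of k m] by (auto simp: band_def)

lemma band_subset_A: "j \<in> {1..n} \<Longrightarrow> band j k \<subseteq> A j"
  using vimage_subset_A level_antimono[of 0 k] by (auto simp: band_def)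

lemma level_Suc_eq: "level (Suc k) = (\<Union>j\<in>{1..n}. band j k)"
proof -
  have "i \<in> {1..n} \<or> i \<in> (+) n ` {1..n} \<longleftrightarrow> i \<in> {1..2 * n}" for i
    by (auto simp: image_iff intro: bexI[of _ "i - n"])
  then have I: "I = {1..n} \<union> (+) n ` {1..n}"
    unfolding I_eq by blast
  have "(\<Union>i\<in>I. f i) = (\<Union>j\<in>{1..n}. f j \<union> f (n + j))" for f :: "nat \<Rightarrow> complex set"
    unfolding I by blast
  then show ?thesis
    by (simp only: level.simps band_def)
qed

text \<open>The sets \<open>A j\<close> are disjoint, so the index of the band containing z cannot
  change with k, and the union moves outside the intersection.\<close>

lemma Inter_level_eq: "(\<Inter>k. level k) = (\<Union>j\<in>{1..n}. \<Inter>k. band j k)"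
proof
  show "(\<Inter>k. level k) \<subseteq> (\<Union>j\<in>{1..n}. \<Inter>k. band j k)"
  proof
    fix z assume z: "z \<in> (\<Inter>k. level k)"
    have ex: "\<exists>j\<in>{1..n}. z \<in> band j k" for k
      using z level_Suc_eq[of k] by blast
    then obtain j where j: "j \<in> {1..n}" "z \<in> band j 0"
      by blast
    have "z \<in> band j k" for k
    proof -
      obtain j' where j': "j' \<in> {1..n}" "z \<in> band j' k"
        using ex by blast
      have "z \<in> A j \<inter> A j'"
        using band_subset_A j j' by blast
      then have "j = j'"
        using A_disjoint j(1) j'(1) unfolding disjoint_family_on_def by blast
      with j' show ?thesis by simp
    qed
    with j(1) show "z \<in> (\<Union>j\<in>{1..n}. \<Inter>k. band j k)"
      by blast
  qed
  show "(\<Union>j\<in>{1..n}. \<Inter>k. band j k) \<subseteq> (\<Inter>k. level k)"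
    using level_Suc_eq level_Suc_subset by blast
qed

text \<open>For each j the bands are nested, compact, connected and nonempty, so their intersection
  is connected and nonempty. The sets \<open>A j\<close> keep different j apart.\<close>

lemma card_components_Julia: "card (components (Julia G)) = n"
proof -
  define C where "C j = (\<Inter>k. band j k)" for j
  have "Julia G = (\<Union>j\<in>{1..n}. Fin ` C j)"
    unfolding Julia_eq Inter_level_eq C_def by (simp only: image_UN)
  moreover have "card (components (\<Union>j\<in>{1..n}. Fin ` C j)) = card {1..n}"
  proof (rule components_Union_disjoint_closed)
    fix j assume j: "j \<in> {1..n}"
    have "compact (C j)"
      unfolding C_def using compact_band[OF j] by (intro compact_Inter) auto
    then show "closed (Fin ` C j)"
      by (intro compact_imp_closed) simp
    have "connected (C j)"
      unfolding C_def
      by (intro connected_nest compact_band connected_band j band_antimono)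
    then show "connected (Fin ` C j)"
      by simp
    have "C j \<noteq> {}"
      unfolding C_def by (intro compact_nest compact_band band_nonempty j band_antimono)
    then show "Fin ` C j \<noteq> {}"
      by simp
  next
    have "C j \<subseteq> A j" if "j \<in> {1..n}" for j
      unfolding C_def using band_subset_A[OF that] by blast
    then show "disjoint_family_on (\<lambda>j. Fin ` C j) {1..n}"
      using A_disjoint unfolding disjoint_family_on_def by fastforce
  qed simp
  ultimately show ?thesis
    by simp
qed

end

section \<open>Perturbations of powers centred at two points\<close>

text \<open>Together with \<open>radius\<close> this describes the circle left invariant by
  \<open>alpha_map i\<close> for i <= n, and by \<open>beta_map \<epsilon> (i - n)\<close> for i >
  n.\<close>

definition center :: "real \<Rightarrow> nat \<Rightarrow> nat \<Rightarrow> complex" where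
  "center \<epsilon> n i = (if i \<le> n then 0 else of_real \<epsilon>)"

definition radius :: "nat \<Rightarrow> nat \<Rightarrow> nat" where
  "radius n i = (if i \<le> n then i else i - n)"

lemma radius_bounds: "i \<in> {1..2 * n} \<Longrightarrow> 1 \<le> radius n i \<and> radius n i \<le> n"
  by (auto simp: radius_def)

lemma norm_center_le: "\<epsilon> \<ge> 0 \<Longrightarrow> norm (center \<epsilon> n i) \<le> \<epsilon>"
  by (simp add: center_def)

text \<open>\<eta> is the half-width of the rings around the circles: 2\<eta> \<le> \<epsilon> links
  the rings of equal radius, and \<epsilon> + \<eta> < 1/2 keeps different radii apart.
  \<open>N\<close> is a degree that ensures expansion by 2, and \<open>M\<close> a growth that
  forces the degree above \<open>N\<close>.\<close>

locale two_circle_system =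
  fixes n N :: nat and \<epsilon> \<eta> r M :: real and P :: "nat \<Rightarrow> complex poly"
  assumes n_pos: "n \<ge> 1" and eps: "0 < \<epsilon>" "0 < \<eta>" "2 * \<eta> \<le> \<epsilon>" "\<epsilon> + \<eta> < 1 / 2"
    and r: "\<epsilon> < r" "r < 1 / 2"
    and N: "N \<ge> 2" "4 * (real n + 1) / (r - \<epsilon>) \<le> real N"
    and M: "((real n + 2) / (1 / 2 - r)) ^ N + 2 \<le> M" "real n + 1 \<le> M"
    and degree_pos: "i \<in> {1..2 * n} \<Longrightarrow> degree (P i) \<ge> 1"
    and disc: "i \<in> {1..2 * n} \<Longrightarrow> norm (z - center \<epsilon> n i) \<le> radius n i - \<eta> \<Longrightarrow>
      norm (poly (P i) z) < r"
    and exterior: "i \<in> {1..2 * n} \<Longrightarrow> norm (z - center \<epsilon> n i) \<ge> radius n i + \<eta> \<Longrightarrow>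
      norm (poly (P i) z) > M"
    and fibre: "i \<in> {1..2 * n} \<Longrightarrow> poly (P i) z = center \<epsilon> n i \<Longrightarrow> norm z < r"
begin

lemma norm_le_disc:
  assumes "i \<in> {1..2 * n}" "norm z \<le> radius n i - \<epsilon> - \<eta>"
  shows "norm (poly (P i) z) < r"
proof (rule disc[OF assms(1)])
  show "norm (z - center \<epsilon> n i) \<le> radius n i - \<eta>"
    using norm_triangle_ineq4[of z "center \<epsilon> n i"] norm_center_le[of \<epsilon> n i] eps assms(2) by simp
qed

lemma norm_ge_exterior:
  assumes "i \<in> {1..2 * n}" "norm z \<ge> radius n i + \<epsilon> + \<eta>"
  shows "norm (poly (P i) z) > M"
proof (rule exterior[OF assms(1)])
  show "norm (z - center \<epsilon> n i) \<ge> radius n i + \<eta>"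
    using norm_triangle_ineq2[of z "center \<epsilon> n i"] norm_center_le[of \<epsilon> n i] eps assms(2) by simp
qed

text \<open>The zeros \<open>a\<close> of \<open>P\<^sub>i - c\<close> lie in the small disc, so \<open>|x - a| / |y - a|\<close> is bounded for
  \<open>x = j + 1\<close> and \<open>y = j - 1/2\<close>, whereas \<open>P\<^sub>i\<close> grows by a large factor from \<open>y\<close> to \<open>x\<close>.\<close>

lemma degree_gt:
  assumes i: "i \<in> {1..2 * n}"
  shows "degree (P i) > N"
proof -
  define c where "c = center \<epsilon> n i"
  define f where "f = P i - [:c:]"
  define C where "C = (real n + 2) / (1 / 2 - r)"
  define x y :: complex where "x = of_real (radius n i + 1)" and "y = of_real (radius n i - 1 / 2)"
  have j: "1 \<le> radius n i" "radius n i \<le> n"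
    using radius_bounds[OF i] by auto
  have nx: "norm x = radius n i + 1" and ny: "norm y = radius n i - 1 / 2"
    using j by (simp_all add: x_def y_def del: of_real_add of_real_diff)
  have c: "norm c \<le> \<epsilon>"
    using norm_center_le[of \<epsilon> n i] eps by (simp add: c_def)
  have "C > 1"
    using r eps by (simp add: C_def field_simps)
  have "norm (x - a) \<le> C * norm (y - a)" if "poly f a = 0" for a
  proof -
    have a: "norm a < r"
      using fibre[OF i, of a] that by (simp add: f_def c_def)
    have "norm (x - a) \<le> real n + 2"
      using norm_triangle_ineq4[of x a] a nx j r by simp
    also have "\<dots> = C * (1 / 2 - r)"
      using r by (simp add: C_def)
    also have "\<dots> \<le> C * norm (y - a)"
      using norm_triangle_ineq2[of y a] a ny j \<open>C > 1\<close> by (intro mult_left_mono) auto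
    finally show ?thesis .
  qed
  then have "norm (poly f x) \<le> C ^ degree f * norm (poly f y)"
    by (rule poly_ratio_le)
  also have "norm (poly f y) \<le> 1"
  proof -
    have "norm (poly (P i) y) < r"
      using ny eps by (intro norm_le_disc[OF i]) simp
    then show ?thesis
      using norm_triangle_ineq4[of "poly (P i) y" c] c r eps by (simp add: f_def)
  qed
  finally have "norm (poly f x) \<le> C ^ degree f"
    using \<open>C > 1\<close> by (simp add: mult_left_mono)
  moreover have "norm (poly f x) > M - 1"
  proof -
    have "norm (poly (P i) x) > M"
      using nx eps by (intro norm_ge_exterior[OF i]) simp
    then show ?thesis
      using norm_triangle_ineq2[of "poly (P i) x" c] c eps r by (simp add: f_def)
  qed
  ultimately have "C ^ N < C ^ degree f"
    using M(1) by (simp add: C_def)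
  then have "N < degree f"
    using \<open>C > 1\<close> power_less_imp_less_exp by blast
  moreover have "degree f \<le> degree (P i)"
    unfolding f_def using degree_diff_le_max[of "P i" "[:c:]"] by simp
  ultimately show ?thesis by simp
qed

text \<open>With c the centre, the zeros of P i - c lie in |z| < r by \<open>fibre\<close>, and the
  degree exceeds \<open>N\<close> by \<open>degree_gt\<close>; the bound for z f'/f then
  applies.\<close>

lemma log_derivative_bound:
  assumes i: "i \<in> {1..2 * n}" and z: "norm z \<ge> r"
  shows "norm z * norm (poly (pderiv (P i)) z) \<ge>
      N / 2 * norm (poly (P i) z - center \<epsilon> n i)"
    and "poly (P i) z \<noteq> center \<epsilon> n i"
proof -
  define f where "f = P i - [:center \<epsilon> n i:]"
  have f: "poly f w = poly (P i) w - center \<epsilon> n i" "pderiv f = pderiv (P i)" for w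
    by (simp_all add: f_def pderiv_diff pderiv_pCons)
  have small: "norm a < norm z" if "poly f a = 0" for a
    using fibre[OF i, of a] that z by (simp add: f)
  then show "poly (P i) z \<noteq> center \<epsilon> n i"
    using f(1)[of z] by force
  then have nz: "poly f z \<noteq> 0"
    by (simp add: f)
  have "degree (P i) = degree f"
  proof -
    have "P i = f + [:center \<epsilon> n i:]"
      by (simp add: f_def)
    moreover have "degree f > 0"
      using \<open>P i = f + _\<close> degree_add_le_max[of f "[:center \<epsilon> n i:]"] degree_gt[OF i] by simp
    ultimately show ?thesis
      by (metis degree_add_eq_left degree_pCons_0)
  qed
  then have "real N / 2 \<le> real (degree f) / 2"
    using degree_gt[OF i] by simp
  also have "\<dots> \<le> Re (z * poly (pderiv f) z / poly f z)"
    using nz small by (intro Re_log_deriv_poly_ge) auto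
  also have "\<dots> \<le> norm (z * poly (pderiv f) z / poly f z)"
    by (rule complex_Re_le_cmod)
  finally show "norm z * norm (poly (pderiv (P i)) z) \<ge> N / 2 * norm (poly (P i) z - center \<epsilon> n i)"
    using nz by (simp add: norm_divide norm_mult f field_simps)
qed

sublocale annular_system "{1..2 * n}" P r "real n + 1"
proof
  fix i z assume i: "i \<in> {1..2 * n}"
  have j: "1 \<le> radius n i" "radius n i \<le> n"
    using radius_bounds[OF i] by auto
  show "degree (P i) \<ge> 2"
    using degree_gt[OF i] N by simp
  have inner: "norm (poly (P i) z) < r" if "norm z \<le> r" for z
    using that j eps r N by (intro norm_le_disc[OF i]) auto
  then show "norm z \<le> r \<Longrightarrow> norm (poly (P i) z) < r" .
  have outer: "norm (poly (P i) z) > real n + 1" if "norm z \<ge> real n + 1" for z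
    using that j eps r M(2) norm_ge_exterior[OF i, of z] by auto
  then show "norm z \<ge> real n + 1 \<Longrightarrow> norm (poly (P i) z) > real n + 1" .
  have c: "norm (center \<epsilon> n i) \<le> \<epsilon>"
    using norm_center_le eps by simp
  then show "\<exists>c. norm c \<le> r \<and> (\<forall>z. poly (P i) z = c \<longrightarrow> norm z \<le> r)"
    using fibre[OF i] r by (intro exI[of _ "center \<epsilon> n i"]) (auto intro: less_imp_le)
  show "norm z \<le> r" if "poly (pderiv (P i)) z = 0"
  proof (rule ccontr)
    assume "\<not> norm z \<le> r"
    then show False
      using log_derivative_bound[OF i, of z] that N by (simp add: mult_le_0_iff)
  qed
  assume ann: "r \<le> norm (poly (P i) z)" "norm (poly (P i) z) \<le> real n + 1"
  have z: "r \<le> norm z" "norm z \<le> real n + 1"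
    using inner[of z] outer[of z] ann by linarith+
  \<comment> \<open>Over the annulus |P i - c| is at least r - \<epsilon>, and |z| is at most n + 1;
    \<open>N\<close> is chosen so that these give a derivative of at least 2.\<close>
  have "(real n + 1) * 2 \<le> N / 2 * (r - \<epsilon>)"
    using N(2) r by (simp add: field_simps)
  also have "\<dots> \<le> N / 2 * norm (poly (P i) z - center \<epsilon> n i)"
    using norm_triangle_ineq2[of "poly (P i) z" "center \<epsilon> n i"] ann c by (intro mult_left_mono) auto
  also have "\<dots> \<le> norm z * norm (poly (pderiv (P i)) z)"
    using log_derivative_bound[OF i z(1)] by blast
  also have "\<dots> \<le> (real n + 1) * norm (poly (pderiv (P i)) z)"
    using z by (intro mult_right_mono) auto
  finally show "norm (poly (pderiv (P i)) z) \<ge> 2"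
    by (rule mult_left_le_imp_le) simp
qed (use n_pos eps r in auto)

text \<open>The preimages of the annulus lie within \<epsilon> + \<eta> < 1/2 of the circles about
  0, so rings of half-width 1/2 serve as the sets \<open>A j\<close>.\<close>

sublocale linked_system "{1..2 * n}" P r "real n + 1" n
  "\<lambda>j. {z. real j - 1 / 2 < norm z \<and> norm z < real j + 1 / 2}"
proof
  show "disjoint_family_on (\<lambda>j. {z :: complex. real j - 1 / 2 < norm z \<and> norm z < real j + 1 / 2}) {1..n}"
  proof -
    have "j = k" if "real j - 1 / 2 < x" "x < real j + 1 / 2" "real k - 1 / 2 < x" "x < real k + 1 / 2" for j k x
    proof -
      have "real j < real (k + 1)" "real k < real (j + 1)"
        using that by simp_all
      then show ?thesis
        by linarith
    qed
    then show ?thesis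
      unfolding disjoint_family_on_def by blast
  qed
  fix j assume j: "j \<in> {1..n}"
  have i: "j \<in> {1..2 * n}" "n + j \<in> {1..2 * n}"
    and rad: "radius n j = j" "radius n (n + j) = j"
    and cen: "center \<epsilon> n j = 0" "center \<epsilon> n (n + j) = of_real \<epsilon>"
    using j by (auto simp: radius_def center_def)
  have ann: "radius n i - \<eta> < norm (z - center \<epsilon> n i) \<and> norm (z - center \<epsilon> n i) < radius n i + \<eta>"
    if "i \<in> {1..2 * n}" "poly (P i) z \<in> annulus" for i z
    using disc[OF that(1), of z] exterior[OF that(1), of z] that(2) M(2) by (force simp: annulus_def)
  show "z \<in> {z. real j - 1 / 2 < norm z \<and> norm z < real j + 1 / 2}" if "poly (P j) z \<in> annulus" for z
    using ann[OF i(1) that] eps by (simp add: rad cen)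
  show "z \<in> {z. real j - 1 / 2 < norm z \<and> norm z < real j + 1 / 2}" if "poly (P (n + j)) z \<in> annulus" for z
    using ann[OF i(2) that] eps norm_triangle_ineq2[of z "of_real \<epsilon>"]
      norm_triangle_ineq4[of z "of_real \<epsilon>"] by (simp add: rad cen)
  fix x :: real assume x: "x \<ge> 0"
  show "norm (poly (P j) (- of_real x)) \<le> r" if "poly (P (n + j)) (- of_real x) \<in> annulus"
  proof -
    have "norm (- of_real x - of_real \<epsilon> :: complex) = x + \<epsilon>"
      using x eps by (simp flip: of_real_minus of_real_diff)
    then have "x + \<epsilon> < real j + \<eta>"
      using ann[OF i(2) that] by (simp add: rad cen)
    \<comment> \<open>Here x < j + \<eta> - \<epsilon> \<le> j - \<eta>, so -x lies in the disc on
      which \<open>P j\<close> is small.\<close>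
    then show ?thesis
      using disc[OF i(1), of "- of_real x"] x eps by (simp add: rad cen)
  qed
  show "norm (poly (P j) (of_real x)) \<ge> real n + 1" if "poly (P (n + j)) (of_real x) \<in> annulus"
  proof -
    have "norm (of_real x - of_real \<epsilon> :: complex) = \<bar>x - \<epsilon>\<bar>"
      by (simp flip: of_real_diff)
    then have "real j - \<eta> < \<bar>x - \<epsilon>\<bar>"
      using ann[OF i(2) that] by (simp add: rad cen)
    \<comment> \<open>The case x < \<epsilon> is impossible because \<epsilon> + \<eta> < 1/2 < j;
      otherwise x > j + \<epsilon> - \<eta> \<ge> j + \<eta>.\<close>
    then have "x \<ge> real j + \<eta>"
      using x eps j by auto
    then show ?thesis
      using exterior[OF i(1), of "of_real x"] x M(2) by (simp add: rad cen)
  qed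
qed simp

end

lemma semigroup_two_circle_system:
  assumes "two_circle_system n N \<epsilon> \<eta> r M P" and h: "\<And>i. i \<in> {1..2 * n} \<Longrightarrow> h i = poly_map (P i)"
  shows "semigroup_gen (h ` {1..2 * n}) \<in> class_G"
    and "card (components (Julia (semigroup_gen (h ` {1..2 * n})))) = n"
proof -
  interpret two_circle_system n N \<epsilon> \<eta> r M P
    by fact
  have "semigroup_gen (h ` {1..2 * n}) = G"
    unfolding G_def maps_def using h by (intro arg_cong[where f = semigroup_gen] image_cong) auto
  then show "semigroup_gen (h ` {1..2 * n}) \<in> class_G"
    "card (components (Julia (semigroup_gen (h ` {1..2 * n})))) = n"
    using G_in_class_G card_components_Julia by simp_all
qed

section \<open>The unperturbed generators\<close>

lemma Poly_maps_funpow: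
  assumes "f \<in> Poly_maps"
  shows "f ^^ l \<in> Poly_maps"
proof (induction l)
  case 0
  have "id = poly_map [:0, 1:]"
  proof
    fix x show "id x = poly_map [:0, 1:] x"
      by (cases x) auto
  qed
  then have "id \<in> Poly_maps"
    unfolding Poly_maps_def by (intro CollectI exI[of _ "[:0, 1:]"]) simp
  then show ?case
    by (simp only: funpow.simps)
next
  case (Suc l)
  then obtain p q where "f ^^ l = poly_map p" "degree p \<ge> 1" "f = poly_map q" "degree q \<ge> 1"
    using assms by (auto simp: Poly_maps_def)
  moreover from this have "1 * 1 \<le> degree q * degree p"
    by (intro mult_mono) auto
  ultimately show ?case
    by (auto simp: Poly_maps_def poly_map_comp degree_pcompose intro!: exI[of _ "pcompose q p"])
qed

definition generator :: "real \<Rightarrow> nat \<Rightarrow> nat \<Rightarrow> nat \<Rightarrow> rsphere \<Rightarrow> rsphere" where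
  "generator \<epsilon> n l i = (if i \<le> n then alpha_map i ^^ l else beta_map \<epsilon> (i - n) ^^ l)"

lemma generator_Poly_maps:
  assumes "i \<in> {1..2 * n}"
  shows "generator \<epsilon> n l i \<in> Poly_maps"
proof -
  have "alpha_map j \<in> Poly_maps" "beta_map \<epsilon> j \<in> Poly_maps" if "j \<ge> 1" for j
  proof -
    have "degree (smult (1 / of_nat j) ([:a, 1:] ^ 2)) = 2" for a :: complex
      using that by (simp add: degree_power_eq)
    moreover from this have "degree (smult (1 / of_nat j) ([:a, 1:] ^ 2) + [:b:]) = 2" for a b :: complex
      by (subst degree_add_eq_left) (simp_all only: degree_pCons_0)
    ultimately show "alpha_map j \<in> Poly_maps" "beta_map \<epsilon> j \<in> Poly_maps"
      unfolding alpha_map_def beta_map_def Poly_maps_def by (metis (mono_tags, lifting) mem_Collect_eq one_le_numeral)+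
  qed
  then show ?thesis
    using assms by (auto simp: generator_def intro!: Poly_maps_funpow)
qed

text \<open>In the coordinate w = (z - c)/j about the centre c, with j the radius, each map is
  squaring, so its l-th iterate is the power 2^l.\<close>

lemma generator_Fin:
  assumes "i \<in> {1..2 * n}"
  shows "generator \<epsilon> n l i (Fin z) =
    Fin (center \<epsilon> n i + of_nat (radius n i) * ((z - center \<epsilon> n i) / of_nat (radius n i)) ^ 2 ^ l)"
proof -
  have sq: "(j * w ^ 2 ^ l)\<^sup>2 / j = j * w ^ 2 ^ Suc l" for j w :: complex and l
    by (simp add: power_mult_distrib power2_eq_square power_mult)
  have "alpha_map j (Fin u) = Fin (u\<^sup>2 / of_nat j)" for j u
    by (simp add: alpha_map_def)
  then have a: "(alpha_map j ^^ l) (Fin z) = Fin (0 + of_nat j * ((z - 0) / of_nat j) ^ 2 ^ l)" if "j \<ge> 1" for j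
    using that by (induction l) (simp_all add: sq del: power_Suc)
  have "beta_map \<epsilon> j (Fin u) = Fin ((u - of_real \<epsilon>)\<^sup>2 / of_nat j + of_real \<epsilon>)" for j u
    unfolding beta_map_def poly_map.simps poly_add poly_smult poly_power by simp
  then have b: "(beta_map \<epsilon> j ^^ l) (Fin z) =
      Fin (of_real \<epsilon> + of_nat j * ((z - of_real \<epsilon>) / of_nat j) ^ 2 ^ l)" if "j \<ge> 1" for j
    using that by (induction l) (simp_all add: sq del: power_Suc)
  show ?thesis
    using assms a[of "radius n i"] b[of "radius n i"]
    by (auto simp: generator_def center_def radius_def)
qed

section \<open>Neighbourhoods in the space of polynomial maps\<close>

text \<open>The sphere is bounded, so the carrier of the function space consists of all maps and the
  set is a metric ball cut down to \<open>Poly_maps\<close>.\<close>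

lemma openin_Poly_topology_ball:
  "openin Poly_topology {f \<in> Poly_maps. mdist (funspace UNIV euclidean_metric) g f < \<kappa>}"
proof -
  define F where "F = funspace (UNIV :: rsphere set) (euclidean_metric :: rsphere metric)"
  have space: "mspace F = UNIV"
    unfolding F_def by (rule mspace_funspace_rsphere)
  interpret Metric_space UNIV "mdist F"
    using Metric_space_mspace_mdist[of F] by (simp only: space)
  have "mtopology_of F = mtopology"
    by (simp only: mtopology_of_def space)
  then have "openin (mtopology_of F) (mball g \<kappa>)"
    by simp
  then have "openin (subtopology (mtopology_of F) Poly_maps) (Poly_maps \<inter> mball g \<kappa>)"
    by (rule openin_subtopology_Int2)
  moreover have "{f \<in> Poly_maps. mdist F g f < \<kappa>} = Poly_maps \<inter> mball g \<kappa>"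
    by auto
  ultimately show ?thesis
    by (simp only: Poly_topology_def F_def)
qed

lemma dist_le_mdist_funspace:
  "dist (f z) (g z) \<le> mdist (funspace UNIV (euclidean_metric :: rsphere metric)) f g"
  unfolding mdist_funspace_rsphere
  by (rule cSUP_upper) (auto intro!: bdd_aboveI2 dist_rsphere_le_pi)

text \<open>The unperturbed generator has room to spare: its absolute value is at most (r +
  \<epsilon>)/2 on the disc and at least M + 1 on the exterior, and its distance to the centre is
  bounded below for |z| \<ge> r. Each gap tolerates a small spherical error.\<close>

lemma perturbed_generator:
  fixes \<epsilon> \<eta> r M :: real
  assumes i: "i \<in> {1..2 * n}" and eps: "0 < \<epsilon>" "\<epsilon> < r" and eta: "0 < \<eta>" "\<eta> < 1"
    and small: "real (radius n i) * ((radius n i - \<eta>) / radius n i) ^ 2 ^ l \<le> (r - \<epsilon>) / 2"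
    and large: "M + 1 + \<epsilon> \<le> real (radius n i) * ((radius n i + \<eta>) / radius n i) ^ 2 ^ l"
  obtains \<kappa> where "\<kappa> > 0" "\<And>p. (\<And>x. dist (generator \<epsilon> n l i x) (poly_map p x) < \<kappa>) \<Longrightarrow>
      (\<forall>z. norm (z - center \<epsilon> n i) \<le> radius n i - \<eta> \<longrightarrow> norm (poly p z) < r) \<and>
      (\<forall>z. norm (z - center \<epsilon> n i) \<ge> radius n i + \<eta> \<longrightarrow> norm (poly p z) > M) \<and>
      (\<forall>z. poly p z = center \<epsilon> n i \<longrightarrow> norm z < r)"
proof -
  define c j where "c = center \<epsilon> n i" and "j = real (radius n i)"
  define g where "g z = c + of_real j * ((z - c) / of_real j) ^ 2 ^ l" for z
  have j: "j \<ge> 1"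
    using radius_bounds[OF i] by (simp add: j_def)
  have c: "norm c \<le> \<epsilon>"
    using norm_center_le eps by (simp add: c_def)
  have gen: "generator \<epsilon> n l i (Fin z) = Fin (g z)" for z
    using generator_Fin[OF i] by (simp add: g_def c_def j_def)
  have norm_g: "norm (g z - c) = j * (norm (z - c) / j) ^ 2 ^ l" for z
    using j by (simp add: g_def norm_mult norm_divide norm_power)
  \<comment> \<open>For |z| \<ge> r the distance of z to c is at least r - \<epsilon>, and m is |g -
    c| at that distance.\<close>
  define m where "m = j * ((r - \<epsilon>) / j) ^ 2 ^ l"
  have m: "m > 0"
    using j eps by (simp add: m_def)
  have g1: "norm (g z) \<le> (r + \<epsilon>) / 2" if "norm (z - c) \<le> j - \<eta>" for z
  proof -
    have "norm (g z - c) \<le> j * ((j - \<eta>) / j) ^ 2 ^ l"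
      unfolding norm_g using that j by (intro mult_left_mono power_mono divide_right_mono) auto
    then show ?thesis
      using norm_triangle_sub[of "g z" c] c small by (simp add: j_def field_simps)
  qed
  have g2: "norm (g z) \<ge> M + 1" if "norm (z - c) \<ge> j + \<eta>" for z
  proof -
    have "norm (g z - c) \<ge> j * ((j + \<eta>) / j) ^ 2 ^ l"
      unfolding norm_g using that j eta by (intro mult_left_mono power_mono divide_right_mono) auto
    then show ?thesis
      using norm_triangle_ineq4[of "g z" c] c large by (simp add: j_def)
  qed
  have g3: "norm (g z - c) \<ge> m" if "norm z \<ge> r" for z
  proof -
    have "norm (z - c) \<ge> r - \<epsilon>"
      using norm_triangle_ineq2[of z c] c that by simp
    then show ?thesis
      unfolding norm_g m_def using j eps by (intro mult_left_mono power_mono divide_right_mono) auto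
  qed
  obtain \<kappa>1 where \<kappa>1: "\<kappa>1 > 0"
      "\<And>u q. u \<in> cball 0 ((r + \<epsilon>) / 2) \<Longrightarrow> dist (Fin u) q < \<kappa>1 \<Longrightarrow> q \<in> Fin ` ball 0 r"
    by (rule finite_compact_nhd[of "cball 0 ((r + \<epsilon>) / 2)" "ball 0 r"]) (use eps in auto)
  \<comment> \<open>The last two conditions are used in contraposed form: the perturbed value is
    taken in a compact set, which forces the unperturbed value too close to it.\<close>
  obtain \<kappa>2 where \<kappa>2: "\<kappa>2 > 0"
      "\<And>u q. u \<in> cball 0 M \<Longrightarrow> dist (Fin u) q < \<kappa>2 \<Longrightarrow> q \<in> Fin ` ball 0 (M + 1)"
    by (rule finite_compact_nhd[of "cball 0 M" "ball 0 (M + 1)"]) auto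
  obtain \<kappa>3 where \<kappa>3: "\<kappa>3 > 0" "\<And>u q. u \<in> {c} \<Longrightarrow> dist (Fin u) q < \<kappa>3 \<Longrightarrow> q \<in> Fin ` ball c m"
    by (rule finite_compact_nhd[of "{c}" "ball c m"]) (use m in auto)
  show ?thesis
  proof (rule that[of "min \<kappa>1 (min \<kappa>2 \<kappa>3)"])
    show "min \<kappa>1 (min \<kappa>2 \<kappa>3) > 0"
      using \<kappa>1 \<kappa>2 \<kappa>3 by simp
    fix p assume close: "\<And>x. dist (generator \<epsilon> n l i x) (poly_map p x) < min \<kappa>1 (min \<kappa>2 \<kappa>3)"
    have d: "dist (Fin (g z)) (Fin (poly p z)) < \<kappa>1" "dist (Fin (poly p z)) (Fin (g z)) < \<kappa>2"
        "dist (Fin (poly p z)) (Fin (g z)) < \<kappa>3" for z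
      using close[of "Fin z"] by (simp_all add: gen dist_commute)
    have "norm (poly p z) < r" if "norm (z - c) \<le> j - \<eta>" for z
      using \<kappa>1(2)[OF _ d(1)[of z]] g1[OF that] by simp
    moreover have "norm (poly p z) > M" if "norm (z - c) \<ge> j + \<eta>" for z
      using \<kappa>2(2)[OF _ d(2)[of z]] g2[OF that] by (cases "norm (poly p z) \<le> M") auto
    moreover have "norm z < r" if "poly p z = c" for z
      using \<kappa>3(2)[OF _ d(3)[of z]] g3[of z] that by (cases "norm z \<ge> r") (auto simp: dist_norm norm_minus_commute)
    ultimately show "(\<forall>z. norm (z - center \<epsilon> n i) \<le> radius n i - \<eta> \<longrightarrow> norm (poly p z) < r) \<and>
        (\<forall>z. norm (z - center \<epsilon> n i) \<ge> radius n i + \<eta> \<longrightarrow> norm (poly p z) > M) \<and>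
        (\<forall>z. poly p z = center \<epsilon> n i \<longrightarrow> norm z < r)"
      by (simp add: c_def j_def)
  qed
qed

lemma eventually_mult_power_le:
  fixes a x b :: real
  assumes "0 \<le> x" "x < 1" "b > 0"
  shows "\<forall>\<^sub>F l in sequentially. a * x ^ 2 ^ l \<le> b"
proof -
  have "filterlim (\<lambda>l. 2 ^ l :: nat) sequentially sequentially"
    by (intro filterlim_subseq strict_monoI) simp
  then have "(\<lambda>l. a * x ^ 2 ^ l) \<longlonglongrightarrow> a * 0"
    using assms by (intro tendsto_mult tendsto_const filterlim_compose[OF LIMSEQ_realpow_zero]) auto
  then show ?thesis
    using assms(3) by (auto dest!: order_tendstoD(2) elim: eventually_mono)
qed

lemma eventually_le_mult_power:
  fixes a x b :: real
  assumes "a > 0" "x > 1"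
  shows "\<forall>\<^sub>F l in sequentially. b \<le> a * x ^ 2 ^ l"
proof -
  have "\<forall>\<^sub>F l in sequentially. \<bar>b\<bar> * (1 / x) ^ 2 ^ l \<le> a"
    using assms by (intro eventually_mult_power_le) auto
  then show ?thesis
  proof eventually_elim
    case (elim l)
    then have "\<bar>b\<bar> \<le> a * x ^ 2 ^ l"
      using assms by (simp add: power_one_over field_simps)
    then show ?case by simp
  qed
qed

lemma eventually_perturbed_semigroup:
  assumes n: "n \<ge> 1" and eps: "0 < \<epsilon>" "\<epsilon> < 1 / 2"
  shows "\<forall>\<^sub>F l in sequentially.
    \<exists>V. openin (product_topology (\<lambda>_. Poly_topology) {1..2 * n}) V \<and>
      (\<lambda>i\<in>{1..2 * n}. generator \<epsilon> n l i) \<in> V \<and>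
      (\<forall>h\<in>V. semigroup_gen (h ` {1..2 * n}) \<in> class_G \<and>
        card (components (Julia (semigroup_gen (h ` {1..2 * n})))) = n)"
proof -
  \<comment> \<open>\<eta> is the smaller of half of \<epsilon>, for the linking, and half of 1/2 -
    \<epsilon>, for the separation. Then \<open>N\<close>, \<open>M\<close>, l and the tolerances
    \<kappa> are chosen in this order.\<close>
  define \<eta> r where "\<eta> = min (\<epsilon> / 2) ((1 / 2 - \<epsilon>) / 2)" and "r = (\<epsilon> + 1 / 2) / 2"
  have eta: "0 < \<eta>" "2 * \<eta> \<le> \<epsilon>" "\<epsilon> + \<eta> < 1 / 2" "\<eta> < 1" and r: "\<epsilon> < r" "r < 1 / 2"
    using eps by (auto simp: \<eta>_def r_def min_def field_simps)
  obtain N0 where N0: "4 * (real n + 1) / (r - \<epsilon>) \<le> real N0"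
    using real_arch_simple by blast
  define N where "N = max 2 N0"
  have N: "N \<ge> 2" "4 * (real n + 1) / (r - \<epsilon>) \<le> real N"
    using N0 by (auto simp: N_def)
  define M where "M = max (((real n + 2) / (1 / 2 - r)) ^ N + 2) (real n + 1)"
  have M: "((real n + 2) / (1 / 2 - r)) ^ N + 2 \<le> M" "real n + 1 \<le> M"
    by (simp_all add: M_def)
  define small large where
    "small l i \<longleftrightarrow> real (radius n i) * ((radius n i - \<eta>) / radius n i) ^ 2 ^ l \<le> (r - \<epsilon>) / 2" and
    "large l i \<longleftrightarrow> M + 1 + \<epsilon> \<le> real (radius n i) * ((radius n i + \<eta>) / radius n i) ^ 2 ^ l" for l i
  have "\<forall>\<^sub>F l in sequentially. \<forall>i\<in>{1..2 * n}. small l i \<and> large l i"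
  \<comment> \<open>With j the radius, (j - \<eta>)/j < 1 < (j + \<eta>)/j, so the powers pass both
    bounds for large l; finitely many indices share one threshold.\<close>
  proof (intro eventually_ball_finite ballI)
    fix i assume "i \<in> {1..2 * n}"
    then have "real (radius n i) \<ge> 1"
      using radius_bounds by simp
    then show "\<forall>\<^sub>F l in sequentially. small l i \<and> large l i"
      unfolding small_def large_def using eta r
      by (intro eventually_conj eventually_mult_power_le eventually_le_mult_power) (auto simp: field_simps)
  qed simp
  then show ?thesis
  proof eventually_elim
    case (elim l)
    have "\<forall>i\<in>{1..2 * n}. \<exists>\<kappa>. \<kappa> > 0 \<and> (\<forall>p. (\<forall>x. dist (generator \<epsilon> n l i x) (poly_map p x) < \<kappa>) \<longrightarrow>
        (\<forall>z. norm (z - center \<epsilon> n i) \<le> radius n i - \<eta> \<longrightarrow> norm (poly p z) < r) \<and>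
        (\<forall>z. norm (z - center \<epsilon> n i) \<ge> radius n i + \<eta> \<longrightarrow> norm (poly p z) > M) \<and>
        (\<forall>z. poly p z = center \<epsilon> n i \<longrightarrow> norm z < r))"
    proof
      fix i assume i: "i \<in> {1..2 * n}"
      then have "small l i" "large l i"
        using elim by auto
      from perturbed_generator[OF i eps(1) r(1) eta(1,4) this[unfolded small_def large_def]]
      show "\<exists>\<kappa>. \<kappa> > 0 \<and> (\<forall>p. (\<forall>x. dist (generator \<epsilon> n l i x) (poly_map p x) < \<kappa>) \<longrightarrow>
        (\<forall>z. norm (z - center \<epsilon> n i) \<le> radius n i - \<eta> \<longrightarrow> norm (poly p z) < r) \<and>
        (\<forall>z. norm (z - center \<epsilon> n i) \<ge> radius n i + \<eta> \<longrightarrow> norm (poly p z) > M) \<and>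
        (\<forall>z. poly p z = center \<epsilon> n i \<longrightarrow> norm z < r))"
        by (metis (no_types, lifting))
    qed
    then obtain \<kappa> where \<kappa>: "\<And>i. i \<in> {1..2 * n} \<Longrightarrow> \<kappa> i > 0"
      and near: "\<And>i p. i \<in> {1..2 * n} \<Longrightarrow> (\<And>x. dist (generator \<epsilon> n l i x) (poly_map p x) < \<kappa> i) \<Longrightarrow>
        (\<forall>z. norm (z - center \<epsilon> n i) \<le> radius n i - \<eta> \<longrightarrow> norm (poly p z) < r) \<and>
        (\<forall>z. norm (z - center \<epsilon> n i) \<ge> radius n i + \<eta> \<longrightarrow> norm (poly p z) > M) \<and>
        (\<forall>z. poly p z = center \<epsilon> n i \<longrightarrow> norm z < r)"
      unfolding bchoice_iff by blast
    \<comment> \<open>A box of balls, open in the product because the index set is finite.\<close>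
    define V where "V = PiE {1..2 * n} (\<lambda>i. {f \<in> Poly_maps.
      mdist (funspace UNIV (euclidean_metric :: rsphere metric)) (generator \<epsilon> n l i) f < \<kappa> i})"
    show ?case
    proof (intro exI conjI ballI)
      show "openin (product_topology (\<lambda>_. Poly_topology) {1..2 * n}) V"
        unfolding V_def by (rule openin_PiE[THEN iffD2, OF finite_atLeastAtMost])
          (intro disjI2 ballI openin_Poly_topology_ball)
      have "mdist (funspace UNIV (euclidean_metric :: rsphere metric)) f f = 0" for f :: "rsphere \<Rightarrow> rsphere"
        by (simp only: mdist_funspace_rsphere dist_self) simp
      then show "(\<lambda>i\<in>{1..2 * n}. generator \<epsilon> n l i) \<in> V"
        unfolding V_def
        by (intro restrict_PiE_iff[THEN iffD2] ballI) (simp only: mem_Collect_eq generator_Poly_maps \<kappa>)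
    next
      fix h assume "h \<in> V"
      then have h: "h i \<in> Poly_maps"
          "mdist (funspace UNIV (euclidean_metric :: rsphere metric)) (generator \<epsilon> n l i) (h i) < \<kappa> i"
        if "i \<in> {1..2 * n}" for i
        using that by (auto simp: V_def PiE_iff)
      have "\<forall>i\<in>{1..2 * n}. \<exists>p. h i = poly_map p \<and> degree p \<ge> 1"
        using h(1) by (auto simp: Poly_maps_def)
      then obtain P where P: "\<And>i. i \<in> {1..2 * n} \<Longrightarrow> h i = poly_map (P i)"
          "\<And>i. i \<in> {1..2 * n} \<Longrightarrow> degree (P i) \<ge> 1"
        by metis
      have close: "dist (generator \<epsilon> n l i x) (poly_map (P i) x) < \<kappa> i" if "i \<in> {1..2 * n}" for i x
        using order.strict_trans1[OF dist_le_mdist_funspace h(2)[OF that]] P(1)[OF that] by simp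
      have "two_circle_system n N \<epsilon> \<eta> r M P"
        by unfold_locales (use n eps eta r N M P(2) near[OF _ close] in blast)+
      from semigroup_two_circle_system[OF this P(1)]
      show "semigroup_gen (h ` {1..2 * n}) \<in> class_G"
        "card (components (Julia (semigroup_gen (h ` {1..2 * n})))) = n"
        by blast+
    qed
  qed
qed

theorem proposition2p25:
  fixes n :: nat
  assumes "n > 1"
  shows "(\<exists>h :: nat \<Rightarrow> rsphere \<Rightarrow> rsphere.
            h ` {1..2*n} \<subseteq> Poly_maps \<and>
            semigroup_gen (h ` {1..2*n}) \<in> class_G \<and>
            card (components (Julia (semigroup_gen (h ` {1..2*n})))) = n)
       \<and> (\<forall>\<epsilon>::real. 0 < \<epsilon> \<and> \<epsilon> < 1/2 \<longrightarrow>
            (\<forall>\<^sub>F l in sequentially.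
               \<exists>V. openin (product_topology (\<lambda>_. Poly_topology) {1..2*n}) V \<and>
                   (\<lambda>i\<in>{1..2*n}. if i \<le> n then alpha_map i ^^ l
                                  else beta_map \<epsilon> (i - n) ^^ l) \<in> V \<and>
                   (\<forall>h\<in>V. semigroup_gen (h ` {1..2*n}) \<in> class_G \<and>
                          card (components (Julia (semigroup_gen (h ` {1..2*n})))) = n)))"
proof (intro conjI allI impI)
  have "\<forall>\<^sub>F l in sequentially. \<exists>V. openin (product_topology (\<lambda>_. Poly_topology) {1..2 * n}) V \<and>
      (\<lambda>i\<in>{1..2 * n}. generator (1 / 4) n l i) \<in> V \<and>
      (\<forall>h\<in>V. semigroup_gen (h ` {1..2 * n}) \<in> class_G \<and>
        card (components (Julia (semigroup_gen (h ` {1..2 * n})))) = n)"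
    using assms by (intro eventually_perturbed_semigroup) auto
  \<comment> \<open>The value 1/4 stands for any \<epsilon> in (0, 1/2). One sufficiently large l is
    enough, and the unperturbed tuple is the example.\<close>
  from eventually_happens'[OF sequentially_bot this] obtain l V where V: "(\<lambda>i\<in>{1..2 * n}. generator (1 / 4) n l i) \<in> V"
      "\<forall>h\<in>V. semigroup_gen (h ` {1..2 * n}) \<in> class_G \<and>
        card (components (Julia (semigroup_gen (h ` {1..2 * n})))) = n"
    by blast
  then show "\<exists>h :: nat \<Rightarrow> rsphere \<Rightarrow> rsphere. h ` {1..2 * n} \<subseteq> Poly_maps \<and>
      semigroup_gen (h ` {1..2 * n}) \<in> class_G \<and>
      card (components (Julia (semigroup_gen (h ` {1..2 * n})))) = n"
    using generator_Poly_maps[of _ n "1 / 4" l]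
    by (intro exI[of _ "\<lambda>i\<in>{1..2 * n}. generator (1 / 4) n l i"]) auto
next
  fix \<epsilon> :: real assume "0 < \<epsilon> \<and> \<epsilon> < 1 / 2"
  then show "\<forall>\<^sub>F l in sequentially. \<exists>V. openin (product_topology (\<lambda>_. Poly_topology) {1..2*n}) V \<and>
      (\<lambda>i\<in>{1..2*n}. if i \<le> n then alpha_map i ^^ l else beta_map \<epsilon> (i - n) ^^ l) \<in> V \<and>
      (\<forall>h\<in>V. semigroup_gen (h ` {1..2*n}) \<in> class_G \<and>
        card (components (Julia (semigroup_gen (h ` {1..2*n})))) = n)"
    using assms eventually_perturbed_semigroup[of n \<epsilon>, unfolded generator_def] by simp
qed

end
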